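(* Let $a<b$ be real numbers and let $f:(a,b)\to\mathbb{R}$ be a locally integrable function satisfying $$\operatorname{osc}(f,I)=\tfrac14\,|Df|(I)\qquad\text{for every nonempty open interval } I\subset\subset(a,b).$$ Then $f$ is affine.
   Context: Locally integrable functions are identified up to Lebesgue-null sets, so "$f$ is affine" means that there are $\alpha,\beta\in\mathbb{R}$ with $f(x)=\alpha x+\beta$ for almost every $x\in(a,b)$. The notation $I\subset\subset(a,b)$ means that the closure of $I$ is a compact subset of $(a,b)$. For a nonempty open interval $I\subset\subset(a,b)$ of length $|I|$, the mean value is $(f)_I:=\frac{1}{|I|}\int_I f\,dx$ and the mean oscillation is $\operatorname{osc}(f,I):=\frac{1}{|I|}\int_I|f-(f)_I|\,dx$. The total variation of the distributional derivative $Df$ on $I$ is $|Df|(I):=\sup\{\int_I f\varphi'\,dx:\varphi\in C_c^\infty(I),\ \|\varphi\|_{L^\infty(I)}\le 1\}\in[0,\infty]$. *)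

theory Defs
  imports "HOL-Analysis.Analysis"
begin

definition locally_integrable_on :: "(real \<Rightarrow> real) \<Rightarrow> real set \<Rightarrow> bool"
    (infix "locally'_integrable'_on" 50) where
  "f locally_integrable_on U \<longleftrightarrow> (\<forall>K. compact K \<longrightarrow> K \<subseteq> U \<longrightarrow> f absolutely_integrable_on K)"

definition compactly_contained :: "real set \<Rightarrow> real set \<Rightarrow> bool"
    (infix "\<subset>\<subset>" 50) where
  "I \<subset>\<subset> U \<longleftrightarrow> compact (closure I) \<and> closure I \<subseteq> U"

definition mean_value :: "(real \<Rightarrow> real) \<Rightarrow> real set \<Rightarrow> real" where
  "mean_value f I = 1 / measure lebesgue I * (LINT x:I|lebesgue. f x)"

definition osc :: "(real \<Rightarrow> real) \<Rightarrow> real set \<Rightarrow> real" where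
  "osc f I = 1 / measure lebesgue I * (LINT x:I|lebesgue. \<bar>f x - mean_value f I\<bar>)"

text \<open>An element of \<open>C\<^sub>c\<^sup>\<infinity>(I)\<close> is represented by its extension by zero to the whole real line.\<close>

definition test_functions :: "real set \<Rightarrow> (real \<Rightarrow> real) set" where
  "test_functions I =
    {\<phi>. (\<forall>n x. (deriv ^^ n) \<phi> field_differentiable at x) \<and>
        compact (closure {x. \<phi> x \<noteq> 0}) \<and> closure {x. \<phi> x \<noteq> 0} \<subseteq> I}"

text \<open>The almost-everywhere bound says that the \<open>L\<^sup>\<infinity>(I)\<close> norm of \<open>\<phi>\<close> is at most \<open>1\<close>.
  The supremum is taken in \<^typ>\<open>ereal\<close>; it is nonnegative because \<open>\<phi> = 0\<close> is admissible.\<close>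

definition total_variation :: "(real \<Rightarrow> real) \<Rightarrow> real set \<Rightarrow> ereal" where
  "total_variation f I =
    (SUP \<phi> \<in> {\<phi> \<in> test_functions I. AE x in lebesgue. x \<in> I \<longrightarrow> \<bar>\<phi> x\<bar> \<le> 1}.
      ereal (LINT x:I|lebesgue. f x * deriv \<phi> x))"

end

theory Submission
  imports Defs
begin

text \<open>
  Put \<open>T(I) = 4 osc(f, I) = |Df|(I)\<close>. Only two properties of the total variation are used: it is
  superadditive, and for monotone \<open>f\<close> it is at most the increment of \<open>f\<close>.

  Comparing the oscillation on an interval with that on its two halves, superadditivity forces the
  mean values on the halves to differ by at least the sum of the oscillations on the halves. It also
  forces an interval of constancy to spread over the whole domain. So unless \<open>f\<close> is constant, the
  second differences of a primitive \<open>G\<close> of \<open>f\<close> never vanish, and have constant sign by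
  connectedness; say \<open>G\<close> is strictly convex, so that \<open>f\<close> is a strictly increasing function \<open>g\<close>.
  A jump would contribute half of its height to the oscillation, hence twice its height to \<open>T\<close>, so
  \<open>g\<close> is continuous; and \<open>T(x, y) = g(y) - g(x)\<close> because summing \<open>T\<close> over pairs of neighbouring
  cells of a partition gives the reverse inequality.

  With \<open>g(t)\<close> the mean value of \<open>g\<close> on \<open>(x, y)\<close>, the hypothesis now reads
  \<open>8 (G(y) - G(t) - g(t) (y - t)) = (y - x) (g(y) - g(x))\<close>. Differentiating in \<open>y\<close> and in \<open>x\<close> shows that
  \<open>g\<close> is continuously differentiable and gives two relations for
  \<open>a = g(y) - g(t)\<close>, \<open>b = g(t) - g(x)\<close>, \<open>s = t - x\<close>, \<open>r = y - t\<close>, \<open>p = g'(x)\<close>, \<open>q = g'(y)\<close>;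
  where \<open>g' > 0\<close> the mixed derivative gives a third one involving \<open>P = g'(t)\<close>, and its derivative
  along the curves of constant mean value, on which \<open>t\<close> is fixed, a fourth one. On short intervals
  these algebraic relations have only the solution \<open>a = b\<close>, \<open>s = r\<close>, \<open>p = q = P\<close>. So \<open>g'\<close> is
  locally constant where it is positive, hence constant.
\<close>

section \<open>The differentiated identity\<close>

text \<open>\<open>A\<close> and \<open>al\<close> stand for the normalized sum and difference of
  the two increments, \<open>si\<close> for the normalized difference of the two lengths. With
  \<open>D = 2 * si - al\<close> the relations combine to \<open>E\<close>, a sum of
  \<open>D^2\<close> and \<open>al^4\<close> with positive weights near \<open>A = 1\<close>, plus a
  mixed term small enough to be absorbed by the arithmetic-geometric inequality.\<close>

lemma rigid_algebra:
  fixes A al si :: real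
  assumes G: "A^2 - al^2 + 4*al* si = A"
    and H: "4*A^2* si^2 + 2*A*al* si - 4*al^2* si^2 + A^3 - 2*A^2*al* si - 3*A*al^2 + 2*al^3* si = A^2 - 3*al^2"
    and A: "\<bar>A - 1\<bar> \<le> 1/10" and al: "\<bar>al\<bar> \<le> 1/10" and si: "\<bar>2* si - al\<bar> \<le> 1/10"
  shows "al = 0" "si = 0" "A = 1"
proof -
  define D where "D = 2* si - al"
  have si_eq: "si = (al + D)/2" by (simp add: D_def)
  have GG: "A^2 = A - al^2 - 2*al*D"
    using G by (simp add: si_eq field_simps power2_eq_square)
  have E: "D^2*(A^2 - 4*A*al^2 - 2*A*al*D) + 3*al^4 + al^3*D*(6 - 2*A) = 0"
  proof -
    have "al = 2 * si - D" by (simp add: D_def)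
    then show ?thesis using G H by algebra
  qed
  have A': "9/10 \<le> A" "A \<le> 11/10" using A by (simp_all only: abs_le_iff) linarith+
  have D': "\<bar>D\<bar> \<le> 1/10" using si by (simp add: D_def)
  have "81/100 \<le> A^2" using A' power_mono[of "9/10" A 2] by (simp add: power2_eq_square)
  moreover have "A * al^2 \<le> 11/10 * (1/100)"
    using A' power_mono[of "\<bar>al\<bar>" "1/10" 2] al by (intro mult_mono) (auto simp: power2_eq_square)
  moreover have "\<bar>A*al*D\<bar> \<le> 11/10 * (1/10) * (1/10)"
    unfolding abs_mult using A' al D' by (intro mult_mono) auto
  ultimately have c: "A^2 - 4*A*al^2 - 2*A*al*D \<ge> 7/10" by linarith
  have 1: "D^2*(A^2 - 4*A*al^2 - 2*A*al*D) \<ge> D^2*(7/10)"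
    using c by (intro mult_left_mono) auto
  have "\<bar>al^3*D*(6-2*A)\<bar> = \<bar>al\<bar> * (al^2 * \<bar>D\<bar>) * \<bar>6-2*A\<bar>"
    by (simp add: abs_mult power3_eq_cube power2_eq_square)
  also have "\<dots> \<le> (1/10) * (al^2 * \<bar>D\<bar>) * (42/10)"
    using al A' by (intro mult_mono mult_nonneg_nonneg) auto
  also have "al^2 * \<bar>D\<bar> \<le> (al^4 + D^2)/2"
    using sum_squares_bound[of "al^2" "\<bar>D\<bar>"] by (simp add: power2_eq_square power4_eq_xxxx)
  finally have 2: "\<bar>al^3*D*(6-2*A)\<bar> \<le> (21/100) * (al^4 + D^2)" by simp
  have "0 \<le> al^4" "0 \<le> D^2" by simp_all
  moreover have "\<And>X Y d a :: real. X + 3*a + Y = 0 \<Longrightarrow> d*(7/10) \<le> X \<Longrightarrow> - Y \<le> (21/100) * (a + d)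
      \<Longrightarrow> 0 \<le> a \<Longrightarrow> 0 \<le> d \<Longrightarrow> d = 0 \<and> a = 0"
    by simp
  ultimately have "D^2 = 0" "al^4 = 0" using E 1 abs_le_D2[OF 2] by blast+
  then show al0: "al = 0" and "si = 0" by (auto simp: si_eq)
  have "A * (A - 1) = 0" using GG al0 by (simp add: power2_eq_square algebra_simps)
  then show "A = 1" using A' by auto
qed

text \<open>After division by powers of \<open>P\<close> and \<open>L\<close>, the relations
  \<open>A\<close> and \<open>B\<close> express \<open>q'\<close> and \<open>p'\<close> through
  \<open>A'\<close>, \<open>al\<close>, \<open>si\<close>, and \<open>G\<close> and \<open>H\<close>
  turn into the two equations of \<open>rigid_algebra\<close>. The numerical estimates place the
  normalized quantities in the region where that lemma applies.\<close>

lemma rigid_interval: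
  fixes a b s r P p q P2 :: real
  defines "L \<equiv> s + r"
  assumes pos: "a > 0" "b > 0" "s > 0" "r > 0" "P > 0"
    and A: "8*a* s = L*(a+b) + L^2*q"
    and B: "8*b*r = L*(a+b) + L^2*p"
    and G: "4*a*b + (4*(a-b)*(s-r) - L*(a+b))*P = 0"
    and H: "4*(b*q*b + a*a*p) + (4*(b*q-a*p)*(s-r) + 4*(a-b)^2 - (a+b)^2 - L*(b*q+a*p))*P = 0"
    and a: "\<bar>a/(P*r) - 1\<bar> \<le> 1/5000" and b: "\<bar>b/(P* s) - 1\<bar> \<le> 1/5000"
    and d: "(a+b)/(P*L) \<ge> 1 - 1/5000" and q: "q/P \<ge> 1 - 1/5000"
  shows "p = P" "q = P"
proof -
  define A' al si where "A' = (a+b)/(P*L)" and "al = (a-b)/(P*L)" and "si = (s-r)/L"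
  have L: "L > 0" using pos by (simp add: L_def)
  have eqs: "a = P*L/2*(A'+al)" "b = P*L/2*(A'-al)" "s = L/2*(1+si)" "r = L/2*(1-si)"
  proof -
    have "A' + al = 2*a/(P*L)" "A' - al = 2*b/(P*L)"
      unfolding A'_def al_def add_divide_distrib[symmetric] diff_divide_distrib[symmetric] by simp_all
    then show "a = P*L/2*(A'+al)" "b = P*L/2*(A'-al)" using pos L by (simp_all del: distrib_left_numeral)
    show "s = L/2*(1+si)" "r = L/2*(1-si)"
      using L by (simp_all add: si_def field_simps L_def)
  qed
  define p' q' where "p' = p/P" and "q' = q/P"
  have pq: "p = P*p'" "q = P*q'" using pos by (auto simp: p'_def q'_def)
  define F where "F = P * L^2"
  have F: "F > 0" using pos L by (simp add: F_def)
  have "F*(2*(A'+al)*(1+si) - A' - q') = 0" "F*(2*(A'-al)*(1-si) - A' - p') = 0"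
    using A B unfolding F_def pq eqs by (simp_all add: field_simps power2_eq_square)
  then have q': "q' = 2*(A'+al)*(1+si) - A'" and p': "p' = 2*(A'-al)*(1-si) - A'"
    using F by auto
  have "F*P*(A'^2 - al^2 + 4*al* si - A') = 0"
    using G unfolding F_def eqs(1-4) by (simp add: field_simps power2_eq_square)
  then have G': "A'^2 - al^2 + 4*al* si = A'" using F pos by simp
  have "F*P^2*((A'-al)^2*q' + (A'+al)^2*p' + 2*((A'-al)*q'-(A'+al)*p')* si + 4*al^2 - A'^2
          - ((A'-al)*q'+(A'+al)*p')/2) = 0"
    using H unfolding F_def eqs(1-4) pq by (simp add: field_simps power2_eq_square)
  then have H': "(A'-al)^2*q' + (A'+al)^2*p' + 2*((A'-al)*q'-(A'+al)*p')* si + 4*al^2 - A'^2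
          - ((A'-al)*q'+(A'+al)*p')/2 = 0" using F pos by simp
  have H'': "4*A'^2* si^2 + 2*A'*al* si - 4*al^2* si^2 + A'^3 - 2*A'^2*al* si - 3*A'*al^2 + 2*al^3* si = A'^2 - 3*al^2"
    using H' unfolding p' q' by algebra
  define u v where "u = a/(P*r)" and "v = b/(P* s)"
  have uv: "\<bar>u - 1\<bar> \<le> 1/5000" "\<bar>v - 1\<bar> \<le> 1/5000" using a b by (auto simp: u_def v_def)
  have "a = u * P * r" "b = v * P * s" using pos by (auto simp: u_def v_def)
  then have au: "A'+al = u*(1-si)" and bv: "A'-al = v * (1+si)"
  proof -
    have "P*L/2*(A'+al - u*(1-si)) = 0"
      using eqs(1) eqs(4) \<open>a = u * P * r\<close> by (simp add: field_simps)
    then show "A'+al = u*(1-si)" using pos L by simp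
    have "P*L/2*(A'-al - v * (1+si)) = 0"
      using eqs(2,3) \<open>b = v * P * s\<close> by (simp add: field_simps)
    then show "A'-al = v * (1+si)" using pos L by simp
  qed
  have si1: "\<bar>si\<bar> < 1" using pos L by (auto simp: si_def L_def field_simps)
  then have si2: "1 - si^2 > 0" by (simp add: abs_square_less_1)
  \<comment> \<open>This controls the asymmetry \<open>si\<close>: both summands on the right are at
    least 1 - 1/5000 and \<open>u\<close> is at most 1 + 1/5000, so \<open>si^2\<close> is at most
    2/5000, the square of 1/50.\<close>
  have "2*u*(1-si^2) = q' + A'" using q' au by (simp add: power2_eq_square algebra_simps)
  moreover have "A' \<ge> 1 - 1/5000" "q' \<ge> 1 - 1/5000" using d q by (simp_all only: A'_def q'_def)
  ultimately have "2*(1 - 1/5000) \<le> 2*u*(1-si^2)" by simp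
  also have "\<dots> \<le> 2*(1+1/5000)*(1-si^2)"
  proof (rule mult_right_mono)
    show "2*u \<le> 2*(1+1/5000)" using abs_le_D1[OF uv(1)] by simp
  qed (use si2 in simp)
  finally have "si^2 \<le> (1/50)^2" by (simp add: power2_eq_square)
  then have si: "\<bar>si\<bar> \<le> 1/50" by (metis abs_le_square_iff abs_of_pos zero_less_divide_1_iff zero_less_numeral)
  have "\<bar>(u - 1)*(1-si)\<bar> \<le> (1/5000)*2" "\<bar>(v - 1)*(1+si)\<bar> \<le> (1/5000)*2"
    unfolding abs_mult using uv si1 by (intro mult_mono; auto)+
  then have "\<bar>u*(1-si) - (1 - si)\<bar> \<le> 1/2500" "\<bar>v * (1+si) - (1 + si)\<bar> \<le> 1/2500"
    by (simp_all add: algebra_simps)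
  then have "\<bar>A' - 1\<bar> \<le> 1/10" "\<bar>al\<bar> \<le> 1/10" "\<bar>2* si - al\<bar> \<le> 1/10"
    using au bv si by linarith+
  from rigid_algebra[OF G' H'' this] have "al = 0" "si = 0" "A' = 1" .
  then show "p = P" "q = P" using pq p' q' by auto
qed

lemma quotient_simp_right:
  fixes x y :: real
  assumes "x < y"
  shows "(a*(s/(y-x))*8*(y-x) - (y-x)*D) / (y-x)^2 = (8*a * s/(y-x) - D)/(y-x)"
proof -
  define L where "L = y - x"
  have "L \<noteq> 0" using assms by (simp add: L_def)
  then have "(a*(s/L)*8*L - L*D) / L^2 = (8*a * s/L - D)/L"
    by (simp add: power2_eq_square diff_divide_distrib)
  then show ?thesis by (simp add: L_def)
qed

lemma quotient_simp_left:
  fixes x y :: real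
  assumes "x < y"
  shows "(- (a*(s/(y-x)))*8*(x-y) - (y-x)*D) / (x-y)^2 = (8*a * s/(y-x) - D)/(y-x)"
proof -
  have "- (a*(s/(y-x)))*8*(x-y) = a*(s/(y-x))*8*(y-x)"
    by (metis (no_types) minus_diff_eq mult_minus_left mult_minus_right)
  then show ?thesis by (simp only: quotient_simp_right[OF assms] power2_commute[of x y])
qed

lemma divided_difference_eq:
  fixes L q X D :: real
  assumes "L \<noteq> 0" "q = (X / L - D) / L"
  shows "X = L * D + L^2 * q"
  using assms by (simp add: field_simps power2_eq_square)

text \<open>The premise of \<open>osc_eq\<close> says that \<open>g t\<close> is the mean value of
  \<open>g\<close> over \<open>(x, y)\<close>. The integrals of \<open>\<bar>g - g t\<bar>\<close>
  to the left and to the right of \<open>t\<close> are then equal, which turns the factor 4 in front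
  of the oscillation into 8.\<close>

locale increasing_osc_identity =
  fixes lo hi :: real and g G :: "real \<Rightarrow> real"
  assumes G: "\<And>x. lo < x \<Longrightarrow> x < hi \<Longrightarrow> (G has_real_derivative g x) (at x)"
    and cont: "\<And>x. lo < x \<Longrightarrow> x < hi \<Longrightarrow> isCont g x"
    and mono: "\<And>x y. lo < x \<Longrightarrow> x < y \<Longrightarrow> y < hi \<Longrightarrow> g x < g y"
    and osc_eq: "\<And>x t y. lo < x \<Longrightarrow> x < t \<Longrightarrow> t < y \<Longrightarrow> y < hi \<Longrightarrow>
           G y - G x = g t * (y - x) \<Longrightarrow> 8 * (G y - G t - g t * (y - t)) = (y - x) * (g y - g x)"
begin

definition ginv :: "real \<Rightarrow> real" where "ginv = inv_into {lo<..<hi} g"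
definition mn :: "real \<Rightarrow> real \<Rightarrow> real" where "mn x y = (G y - G x) / (y - x)"
text \<open>The unique point at which \<open>g\<close> takes its mean value over
  \<open>(x, y)\<close>; it exists by the mean value theorem for \<open>G\<close>.\<close>

definition md :: "real \<Rightarrow> real \<Rightarrow> real" where "md x y = ginv (mn x y)"

lemma inj: "inj_on g {lo<..<hi}"
  by (rule inj_onI, rule ccontr) (metis greaterThanLessThan_iff less_irrefl linorder_neqE_linordered_idom mono)

lemma ginv_g: "lo < t \<Longrightarrow> t < hi \<Longrightarrow> ginv (g t) = t"
  unfolding ginv_def using inj by (intro inv_into_f_f) auto

lemma md:
  assumes "lo < x" "x < y" "y < hi"
  shows md_gt: "x < md x y" and md_lt: "md x y < y" and g_md: "g (md x y) = mn x y"
proof -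
  obtain z where z: "x < z" "z < y" "G y - G x = (y - x) * g z"
    using MVT2[of x y G g] assms G by force
  then have "mn x y = g z" using assms by (simp add: mn_def)
  then have "md x y = z" unfolding md_def using z assms by (simp add: ginv_g)
  with z \<open>mn x y = g z\<close> show "x < md x y" "md x y < y" "g (md x y) = mn x y" by auto
qed

lemma isCont_ginv:
  assumes "lo < t" "t < hi" shows "isCont ginv (g t)"
proof -
  obtain c d where cd: "lo < c" "c < t" "t < d" "d < hi"
    using dense[OF assms(1)] dense[OF assms(2)] by blast
  show ?thesis
    by (rule isCont_inverse_function2[of c t d]) (use cd in \<open>simp_all add: ginv_g cont\<close>)
qed

lemma mn_deriv_right:
  assumes "lo < x" "x < y" "y < hi"
  shows "((\<lambda>y. mn x y) has_real_derivative (g y - mn x y)/(y-x)) (at y)"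
proof -
  have "((\<lambda>y. mn x y) has_real_derivative
      ((g y - 0) * (y - x) - (G y - G x) * (1 - 0)) / ((y - x) * (y - x))) (at y)"
    unfolding mn_def using assms by (intro DERIV_divide DERIV_diff G DERIV_const DERIV_ident) simp_all
  also have "((g y - 0) * (y - x) - (G y - G x) * (1 - 0)) / ((y - x) * (y - x)) = (g y - mn x y)/(y-x)"
    using assms by (simp add: mn_def diff_divide_distrib)
  finally show ?thesis .
qed

lemma mn_deriv_left:
  assumes "lo < x" "x < y" "y < hi"
  shows "((\<lambda>x. mn x y) has_real_derivative (mn x y - g x)/(y-x)) (at x)"
proof -
  have "((\<lambda>x. mn x y) has_real_derivative
      ((0 - g x) * (y - x) - (G y - G x) * (0 - 1)) / ((y - x) * (y - x))) (at x)"
    unfolding mn_def using assms by (intro DERIV_divide DERIV_diff G DERIV_const DERIV_ident) simp_all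
  also have "((0 - g x) * (y - x) - (G y - G x) * (0 - 1)) / ((y - x) * (y - x)) = (mn x y - g x)/(y-x)"
    using assms by (simp add: mn_def diff_divide_distrib)
  finally show ?thesis .
qed

text \<open>\<open>K\<close> is minus the Legendre transform of \<open>G\<close>, hence differentiable although \<open>g\<close> is not yet known to be.\<close>

definition K :: "real \<Rightarrow> real" where "K m = G (ginv m) - m * ginv m"

text \<open>With \<open>u = ginv m\<close>, the mean value theorem for \<open>G\<close> writes the
  first-order remainder as \<open>(u - t) * (g w - m)\<close> for some \<open>w\<close> between
  \<open>u\<close> and \<open>t\<close>. Monotonicity bounds the second factor by
  \<open>\<bar>m - g t\<bar>\<close>, and continuity of \<open>ginv\<close> makes the first one
  vanish in the limit.\<close>

lemma K_deriv:
  assumes "lo < t" "t < hi"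
  shows "(K has_real_derivative - t) (at (g t))"
proof -
  obtain c d where cd: "lo < c" "c < t" "t < d" "d < hi"
    using dense[OF assms(1)] dense[OF assms(2)] by blast
  have cg: "continuous_on {c..d} g"
    using cd by (intro continuous_at_imp_continuous_on) (auto intro: cont)
  have ev: "\<forall>\<^sub>F m in at (g t). m \<in> {g c<..<g d}"
    by (rule eventually_at_in_open') (use mono cd in auto)
  have bound: "\<bar>K m - K (g t) + t * (m - g t)\<bar> \<le> \<bar>ginv m - t\<bar> * \<bar>m - g t\<bar>"
    if m: "m \<in> {g c<..<g d}" for m
  proof -
    obtain u where u: "c \<le> u" "u \<le> d" "g u = m"
      using IVT'[of g c m d] m cd cg by auto
    have gi: "ginv m = u" "ginv (g t) = t" using u cd assms ginv_g by auto
    have main: "\<exists>w. G u - G t = (u - t) * g w \<and> \<bar>g w - m\<bar> \<le> \<bar>m - g t\<bar>"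
    proof (cases u t rule: linorder_cases)
      case less
      then obtain w where w: "u < w" "w < t" "G t - G u = (t - u) * g w"
        using MVT2[of u t G g] cd u G by force
      have "g u < g w" "g w < g t" using w cd u by (auto intro!: mono)
      then show ?thesis using w u by (intro exI[of _ w]) (auto simp: algebra_simps)
    next
      case equal then show ?thesis using u by auto
    next
      case greater
      then obtain w where w: "t < w" "w < u" "G u - G t = (u - t) * g w"
        using MVT2[of t u G g] cd u G by force
      have "g t < g w" "g w < g u" using w cd u by (auto intro!: mono)
      then show ?thesis using w u by (intro exI[of _ w]) (auto simp: algebra_simps)
    qed
    then obtain w where w: "G u - G t = (u - t) * g w" "\<bar>g w - m\<bar> \<le> \<bar>m - g t\<bar>" by blast
    have "K m - K (g t) + t * (m - g t) = (u - t) * (g w - m)"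
      using w unfolding K_def gi by (simp add: algebra_simps)
    then show ?thesis using w gi by (simp add: abs_mult mult_left_mono)
  qed
  have "((\<lambda>m. (K m - K (g t)) / (m - g t) - (- t)) \<longlongrightarrow> 0) (at (g t))"
  proof (rule Lim_null_comparison)
    show "\<forall>\<^sub>F m in at (g t). norm ((K m - K (g t)) / (m - g t) - (- t)) \<le> \<bar>ginv m - t\<bar>"
      using ev eventually_neq_at_within[of "g t" "g t"]
    proof eventually_elim
      case (elim m)
      have "(K m - K (g t)) / (m - g t) - (- t) = (K m - K (g t) + t * (m - g t)) / (m - g t)"
        using elim by (simp add: field_simps)
      then show ?case using bound[OF elim(1)] elim(2) by (simp add: divide_le_eq)
    qed
    have "(ginv \<longlongrightarrow> t) (at (g t))"
      using isCont_ginv[OF assms] ginv_g[OF assms] by (simp add: isCont_def)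
    then have "((\<lambda>m. ginv m - t) \<longlongrightarrow> 0) (at (g t))" by (simp add: LIM_zero)
    then show "((\<lambda>m. \<bar>ginv m - t\<bar>) \<longlongrightarrow> 0) (at (g t))" by (rule tendsto_rabs_zero)
  qed
  then show ?thesis unfolding has_field_derivative_iff by (rule LIM_zero_cancel)
qed

text \<open>\<open>K\<close> at the mean value is \<open>G t - g t * t\<close> for
  \<open>t = md x y\<close>, so the intermediate point disappears from the oscillation identity. The
  two versions agree because \<open>G z - mn x y * z\<close> has the same value at
  \<open>z = x\<close> and \<open>z = y\<close>.\<close>

lemma osc_K:
  assumes "lo < x" "x < y" "y < hi"
  shows "8 * (G y - K (mn x y) - mn x y * y) = (y - x) * (g y - g x)"
    and "8 * (G x - K (mn x y) - mn x y * x) = (y - x) * (g y - g x)"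
proof -
  note m = md[OF assms]
  have "G y - G x = g (md x y) * (y - x)" using assms m by (simp add: mn_def)
  from osc_eq[OF assms(1) m(1,2) assms(3) this] m
  show 1: "8 * (G y - K (mn x y) - mn x y * y) = (y - x) * (g y - g x)"
    unfolding K_def md_def[symmetric] by (simp add: algebra_simps)
  have "G x - mn x y * x = G y - mn x y * y" using assms by (simp add: mn_def field_simps)
  then show "8 * (G x - K (mn x y) - mn x y * x) = (y - x) * (g y - g x)" using 1 by argo
qed

text \<open>Solving \<open>osc_K\<close> for the value of \<open>g\<close> at the right end point
  gives \<open>?R\<close>, built from \<open>G\<close>, \<open>K\<close> and \<open>mn\<close>, all
  of which are differentiable. So \<open>g\<close> inherits a derivative that was not
  assumed.\<close>

lemma g_deriv_right:
  assumes xy: "lo < x" "x < y" "y < hi"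
  shows "(g has_real_derivative
     (8 * (g y - mn x y) * (md x y - x) / (y - x) - (g y - g x)) / (y - x)) (at y)"
proof -
  let ?R = "\<lambda>z. g x + 8 * (G z - K (mn x z) - mn x z * z) / (z - x)"
  have K: "((\<lambda>z. K (mn x z)) has_real_derivative (- md x y) * ((g y - mn x y)/(y-x))) (at y)"
    using K_deriv[of "md x y"] md[OF xy] xy mn_deriv_right[OF xy] by (intro DERIV_chain2[of K]) auto
  have "(?R has_real_derivative
     ((g y - (- md x y) * ((g y - mn x y)/(y-x)) - ((g y - mn x y)/(y-x) * y + mn x y)) * 8 * (y - x)
       - 8 * (G y - K (mn x y) - mn x y * y)) / (y - x)^2) (at y)"
  proof (rule DERIV_cong)
    show "(?R has_real_derivative 0 +
       (8 * (g y - (- md x y) * ((g y - mn x y)/(y-x)) - ((g y - mn x y)/(y-x) * y + 1 * mn x y)) * (y - x)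
       - 8 * (G y - K (mn x y) - mn x y * y) * (1 - 0)) / ((y - x) * (y - x))) (at y)"
      using xy by (intro DERIV_add DERIV_divide DERIV_diff DERIV_cmult DERIV_mult mn_deriv_right
          G K DERIV_const DERIV_ident) simp_all
  qed (simp add: power2_eq_square mult_ac)
  also have "((g y - (- md x y) * ((g y - mn x y)/(y-x)) - ((g y - mn x y)/(y-x) * y + mn x y)) * 8 * (y - x)
       - 8 * (G y - K (mn x y) - mn x y * y)) / (y - x)^2
     = (8 * (g y - mn x y) * (md x y - x) / (y - x) - (g y - g x)) / (y - x)"
  proof -
    have "g y - (- md x y) * ((g y - mn x y)/(y-x)) - ((g y - mn x y)/(y-x) * y + mn x y)
        = (g y - mn x y) * (1 + (md x y - y)/(y-x))"
      by (simp add: add_divide_distrib diff_divide_distrib algebra_simps)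
    also have "1 + (md x y - y)/(y-x) = (md x y - x)/(y-x)" using xy by (simp add: field_simps)
    finally have "g y - (- md x y) * ((g y - mn x y)/(y-x)) - ((g y - mn x y)/(y-x) * y + mn x y)
        = (g y - mn x y) * ((md x y - x)/(y-x))" .
    then show ?thesis unfolding osc_K[OF xy] by (simp only: quotient_simp_right[OF xy(2)])
  qed
  finally show ?thesis
  proof (rule has_field_derivative_transform_within_open[where S = "{x<..<hi}"])
    fix z assume z: "z \<in> {x<..<hi}"
    then show "?R z = g z" using osc_K(1)[of x z] xy by simp
  qed (use xy in auto)
qed

lemma g_deriv_left:
  assumes xy: "lo < x" "x < y" "y < hi"
  shows "(g has_real_derivative
     (8 * (mn x y - g x) * (y - md x y) / (y - x) - (g y - g x)) / (y - x)) (at x)"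
proof -
  let ?R = "\<lambda>z. g y + 8 * (G z - K (mn z y) - mn z y * z) / (z - y)"
  have K: "((\<lambda>z. K (mn z y)) has_real_derivative (- md x y) * ((mn x y - g x)/(y-x))) (at x)"
    using K_deriv[of "md x y"] md[OF xy] xy mn_deriv_left[OF xy] by (intro DERIV_chain2[of K]) auto
  have "(?R has_real_derivative
     ((g x - (- md x y) * ((mn x y - g x)/(y-x)) - ((mn x y - g x)/(y-x) * x + mn x y)) * 8 * (x - y)
       - 8 * (G x - K (mn x y) - mn x y * x)) / (x - y)^2) (at x)"
  proof (rule DERIV_cong)
    show "(?R has_real_derivative 0 +
       (8 * (g x - (- md x y) * ((mn x y - g x)/(y-x)) - ((mn x y - g x)/(y-x) * x + 1 * mn x y)) * (x - y)
       - 8 * (G x - K (mn x y) - mn x y * x) * (1 - 0)) / ((x - y) * (x - y))) (at x)"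
      using xy by (intro DERIV_add DERIV_divide DERIV_diff DERIV_cmult DERIV_mult mn_deriv_left
          G K DERIV_const DERIV_ident) simp_all
  qed (simp add: power2_eq_square mult_ac)
  also have "((g x - (- md x y) * ((mn x y - g x)/(y-x)) - ((mn x y - g x)/(y-x) * x + mn x y)) * 8 * (x - y)
       - 8 * (G x - K (mn x y) - mn x y * x)) / (x - y)^2
     = (8 * (mn x y - g x) * (y - md x y) / (y - x) - (g y - g x)) / (y - x)"
  proof -
    have "g x - (- md x y) * ((mn x y - g x)/(y-x)) - ((mn x y - g x)/(y-x) * x + mn x y)
        = - ((mn x y - g x) * (1 - (md x y - x)/(y-x)))"
      by (simp add: add_divide_distrib diff_divide_distrib algebra_simps)
    also have "1 - (md x y - x)/(y-x) = (y - md x y)/(y-x)" using xy by (simp add: field_simps)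
    finally have "g x - (- md x y) * ((mn x y - g x)/(y-x)) - ((mn x y - g x)/(y-x) * x + mn x y)
        = - ((mn x y - g x) * ((y - md x y)/(y-x)))" .
    then show ?thesis unfolding osc_K[OF xy] by (simp only: quotient_simp_left[OF xy(2)])
  qed
  finally show ?thesis
  proof (rule has_field_derivative_transform_within_open[where S = "{lo<..<y}"])
    fix z assume z: "z \<in> {lo<..<y}"
    then show "?R z = g z" using osc_K(2)[of z y] xy by (simp add: field_simps)
  qed (use xy in auto)
qed

lemma g_deriv:
  assumes "lo < x" "x < hi" shows "(g has_real_derivative deriv g x) (at x)"
proof -
  obtain y where "x < y" "y < hi" using dense assms by blast
  from g_deriv_left[OF assms(1) this] show ?thesis using DERIV_imp_deriv by metis
qed

text \<open>Together with \<open>deriv_left\<close>, this supplies the relations \<open>A\<close>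
  and \<open>B\<close> of \<open>rigid_interval\<close>.\<close>

lemma deriv_right:
  assumes "lo < x" "x < y" "y < hi"
  shows "8 * (g y - mn x y) * (md x y - x) = (y - x) * (g y - g x) + (y - x)^2 * deriv g y"
  by (rule divided_difference_eq) (use DERIV_imp_deriv[OF g_deriv_right[OF assms]] assms in simp_all)

lemma deriv_left:
  assumes "lo < x" "x < y" "y < hi"
  shows "8 * (mn x y - g x) * (y - md x y) = (y - x) * (g y - g x) + (y - x)^2 * deriv g x"
  by (rule divided_difference_eq) (use DERIV_imp_deriv[OF g_deriv_left[OF assms]] assms in simp_all)

lemma isCont_md:
  assumes "lo < x" "x < y" "y < hi"
  shows "isCont (\<lambda>y. md x y) y"
proof -
  have "isCont ginv (mn x y)" using isCont_ginv[of "md x y"] md[OF assms] assms by simp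
  from isCont_o2[OF DERIV_isCont[OF mn_deriv_right[OF assms]] this]
  have "isCont (\<lambda>y. ginv (mn x y)) y" .
  moreover have "md x = (\<lambda>y. ginv (mn x y))" by (simp add: fun_eq_iff md_def)
  ultimately show ?thesis by simp
qed

text \<open>For a fixed left end point \<open>x\<close>, the formula of \<open>g_deriv_right\<close>
  is continuous in the right end point.\<close>

lemma isCont_deriv:
  assumes y: "lo < y" "y < hi" shows "isCont (deriv g) y"
proof -
  obtain x where x: "lo < x" "x < y" using dense y by blast
  note xy = x(1) x(2) y(2)
  let ?f = "\<lambda>z. (8 * (g z - mn x z) * (md x z - x) / (z - x) - (g z - g x)) / (z - x)"
  have "isCont ?f y"
    using cont[OF y] DERIV_isCont[OF mn_deriv_right[OF xy]] isCont_md[OF xy] x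
    by (intro continuous_intros) auto
  moreover have "\<forall>\<^sub>F z in nhds y. deriv g z = ?f z"
  proof (rule eventually_mono[OF eventually_nhds_in_open[of "{x<..<hi}"]])
    fix z assume "z \<in> {x<..<hi}"
    then show "deriv g z = ?f z" using DERIV_imp_deriv[OF g_deriv_right[of x z]] x by simp
  qed (use xy in auto)
  ultimately show ?thesis by (simp add: isCont_cong)
qed

section \<open>Second-order relations where the derivative is nonzero\<close>

lemma ginv_deriv:
  assumes t: "lo < t" "t < hi" and "deriv g t \<noteq> 0"
  shows "(ginv has_real_derivative inverse (deriv g t)) (at (g t))"
proof -
  obtain c d where cd: "lo < c" "c < t" "t < d" "d < hi"
    using dense[OF assms(1)] dense[OF assms(2)] by blast
  have cg: "continuous_on {c..d} g"
    using cd by (intro continuous_at_imp_continuous_on) (auto intro: cont)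
  show ?thesis
  proof (rule DERIV_inverse_function)
    show "(g has_real_derivative deriv g t) (at (ginv (g t)))" using g_deriv[OF t] ginv_g[OF t] by simp
    show "g c < g t" "g t < g d" using cd by (simp_all add: mono)
    show "isCont ginv (g t)" using isCont_ginv[OF t] .
    fix m assume m: "g c < m" "m < g d"
    obtain u where "c \<le> u" "u \<le> d" "g u = m" using IVT'[of g c m d] m cd cg by auto
    then show "g (ginv m) = m" using ginv_g[of u] cd by auto
  qed fact
qed

lemma md_deriv_right:
  assumes xy: "lo < x" "x < y" "y < hi" and P: "deriv g (md x y) \<noteq> 0"
  shows "((\<lambda>y. md x y) has_real_derivative (g y - mn x y)/(y-x)/deriv g (md x y)) (at y)"
proof -
  note m = md[OF xy]
  have "(ginv has_real_derivative inverse (deriv g (md x y))) (at (mn x y))"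
    using ginv_deriv[of "md x y"] m xy P by simp
  from DERIV_chain2[OF this mn_deriv_right[OF xy]] show ?thesis
    unfolding md_def[symmetric] by (simp add: field_simps)
qed

lemma md_deriv_left:
  assumes xy: "lo < x" "x < y" "y < hi" and P: "deriv g (md x y) \<noteq> 0"
  shows "((\<lambda>x. md x y) has_real_derivative (mn x y - g x)/(y-x)/deriv g (md x y)) (at x)"
proof -
  note m = md[OF xy]
  have "(ginv has_real_derivative inverse (deriv g (md x y))) (at (mn x y))"
    using ginv_deriv[of "md x y"] m xy P by simp
  from DERIV_chain2[OF this mn_deriv_left[OF xy]] show ?thesis
    unfolding md_def[symmetric] by (simp add: field_simps)
qed

text \<open>Obtained by differentiating \<open>deriv_right\<close> with respect to the left end point.\<close>

lemma mixed_relation: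
  assumes xy: "lo < x" "x < y" "y < hi" and P: "deriv g (md x y) \<noteq> 0"
  defines "a \<equiv> g y - mn x y" and "b \<equiv> mn x y - g x" and "s \<equiv> md x y - x" and "r \<equiv> y - md x y"
  shows "4*a*b + (4*(a-b)*(s-r) - (s+r)*(a+b)) * deriv g (md x y) = 0"
proof -
  let ?q = "deriv g y" and ?p = "deriv g x"
  define P L where "P = deriv g (md x y)" and "L = y - x"
  have L: "L > 0" "L = s + r" using xy by (auto simp: L_def s_def r_def)
  \<comment> \<open>These are the two sides of \<open>deriv_right\<close> as functions of the left
    end point. As \<open>y\<close> is fixed, \<open>?q\<close> is a constant, so no second
    derivative of \<open>g\<close> appears.\<close>
  let ?l = "\<lambda>z. 8 * ((g y - mn z y) * (md z y - z))"
  let ?r = "\<lambda>z. (y - z) * (g y - g z) + (y - z) * (y - z) * ?q"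
  have l: "(?l has_real_derivative 8 * ((0 - b/L) * s + (b/L/P - 1) * a)) (at x)"
    unfolding a_def b_def s_def L_def P_def
    by (intro DERIV_cmult DERIV_mult DERIV_diff DERIV_const DERIV_ident mn_deriv_left[OF xy] md_deriv_left[OF xy P])
  have "(?r has_real_derivative ((0 - 1) * (g y - g x) + (0 - ?p) * L) + ((0 - 1) * L + (0 - 1) * L) * ?q) (at x)"
    unfolding L_def using xy
    by (intro DERIV_add DERIV_cmult_right DERIV_mult DERIV_diff DERIV_const DERIV_ident g_deriv) auto
  then have "(?l has_real_derivative ((0 - 1) * (g y - g x) + (0 - ?p) * L) + ((0 - 1) * L + (0 - 1) * L) * ?q) (at x)"
  proof (rule has_field_derivative_transform_within_open[where S = "{lo<..<y}"])
    fix z assume "z \<in> {lo<..<y}"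
    then show "?r z = ?l z" using deriv_right[of z y] xy by (simp only: power2_eq_square mult.assoc greaterThanLessThan_iff)
  qed (use xy in auto)
  from DERIV_unique[OF l this]
  have e: "8 * ((b/L/P - 1) * a - b/L * s) = - (a + b) - ?p * L - 2 * L * ?q"
    by (simp add: a_def b_def)
  have A: "8 * a * s = L * (a+b) + L^2 * ?q" and B: "8 * b * r = L * (a+b) + L^2 * ?p"
    using deriv_right[OF xy] deriv_left[OF xy] by (simp_all add: a_def b_def s_def r_def L_def)
  have P': "P \<noteq> 0" using P by (simp add: P_def)
  have "8 * ((b/L/P - 1) * a - b/L * s) * (L * P) = 8 * (a*b - a*L*P - b * s*P)"
  proof -
    have "L \<noteq> 0" using L(1) by simp
    then show ?thesis using P' by (simp add: field_simps)
  qed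
  with e have "8 * (a*b - a*L*P - b * s*P) = (- (a + b) - ?p * L - 2 * L * ?q) * (L * P)" by simp
  also have "\<dots> = (- L*(a+b) - L^2 * ?p - 2 * (L^2 * ?q)) * P" by (simp add: algebra_simps power2_eq_square)
  \<comment> \<open>\<open>A\<close> and \<open>B\<close> eliminate the derivatives at both end
    points, leaving only the one at the mean point.\<close>
  also have "\<dots> = (- L*(a+b) - (8*b*r - L*(a+b)) - 2 * (8 * a * s - L*(a+b))) * P" using A B by simp
  finally show ?thesis unfolding P_def[symmetric] L(2) by (simp add: algebra_simps)
qed

text \<open>In the formula of \<open>g_deriv_right\<close> the only factor of doubtful
  differentiability is \<open>md\<close>, and it is differentiable where \<open>deriv g\<close> is
  nonzero at the mean point. Choosing \<open>x\<close> close to \<open>y\<close> keeps the mean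
  point in a neighbourhood of \<open>y\<close> on which \<open>deriv g\<close> is positive.\<close>

lemma deriv_differentiable:
  assumes y: "lo < y" "y < hi" and pos: "deriv g y > 0"
  obtains P2 where "(deriv g has_real_derivative P2) (at y)"
proof -
  obtain e where e: "e > 0" "\<And>z. \<bar>z - y\<bar> < e \<Longrightarrow> deriv g z > 0"
  proof -
    have "\<forall>\<^sub>F z in nhds y. deriv g z > 0"
      using isCont_deriv[OF y] pos by (auto simp: isCont_def tendsto_at_iff_tendsto_nhds intro: order_tendstoD)
    then show ?thesis using that by (auto simp: eventually_nhds_metric dist_real_def)
  qed
  obtain x where x: "lo < x" "x < y" "y - e < x"
    using dense[of "max lo (y-e)" y] y e(1) by auto
  note xy = x(1) x(2) y(2)
  have "deriv g (md x y) > 0" using md[OF xy] x by (intro e(2)) auto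
  then have P: "deriv g (md x y) \<noteq> 0" by simp
  have "\<exists>D. ((\<lambda>z. (8 * ((g z - mn x z) * (md x z - x)) / (z - x) - (g z - g x)) / (z - x)) has_real_derivative D) (at y)"
    by (rule exI, (rule mn_deriv_right[OF xy] md_deriv_right[OF xy P] g_deriv[OF y] DERIV_divide DERIV_diff
        DERIV_cmult DERIV_mult DERIV_const DERIV_ident | use x in simp)+)
  then obtain D where "((\<lambda>z. (8 * ((g z - mn x z) * (md x z - x)) / (z - x) - (g z - g x)) / (z - x)) has_real_derivative D) (at y)"
    by blast
  then have "(deriv g has_real_derivative D) (at y)"
  proof (rule has_field_derivative_transform_within_open[where S = "{x<..<hi}"])
    fix z assume "z \<in> {x<..<hi}"
    then show "(8 * ((g z - mn x z) * (md x z - x)) / (z - x) - (g z - g x)) / (z - x) = deriv g z"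
      using DERIV_imp_deriv[OF g_deriv_right[of x z]] x by (simp only: mult.assoc greaterThanLessThan_iff)
  qed (use xy in auto)
  then show ?thesis by (rule that)
qed

text \<open>The second derivative of \<open>g\<close> drops out of the derivative of \<open>mixed_relation\<close>
  in the direction along which the mean value is constant.\<close>

lemma mixed_relation_deriv:
  assumes xy: "lo < x" "x < y" "y < hi" and pos: "\<And>z. x \<le> z \<Longrightarrow> z \<le> y \<Longrightarrow> deriv g z > 0"
  defines "a \<equiv> g y - mn x y" and "b \<equiv> mn x y - g x" and "s \<equiv> md x y - x" and "r \<equiv> y - md x y"
    and "p \<equiv> deriv g x" and "q \<equiv> deriv g y"
  shows "4*(b*q*b + a*a*p) + (4*(b*q-a*p)*(s-r) + 4*(a-b)^2 - (a+b)^2 - (s+r)*(b*q+a*p))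
           * deriv g (md x y) = 0"
proof -
  define P L where "P = deriv g (md x y)" and "L = y - x"
  have L: "L > 0" "s + r = L" using xy by (auto simp: L_def s_def r_def)
  note m = md[OF xy]
  have P: "P > 0" using pos m by (simp add: P_def)
  then have P0: "deriv g (md x y) \<noteq> 0" by (simp add: P_def)
  obtain P2 where P2: "(deriv g has_real_derivative P2) (at (md x y))"
    using deriv_differentiable[of "md x y"] m xy pos by (metis less_imp_le order.strict_trans)
  let ?E = "\<lambda>x y. 4*((g y - mn x y) * (mn x y - g x)) + (4*((g y - mn x y - (mn x y - g x)) * (md x y - x - (y - md x y)))
      - (y - x) * (g y - g x)) * deriv g (md x y)"
  have E0: "?E x' y' = 0" if "lo < x'" "x' < y'" "y' < hi" "deriv g (md x' y') > 0" for x' y'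
    using mixed_relation[OF that(1-3)] that(4) by (simp add: algebra_simps)
  have my: "((\<lambda>y. mn x y) has_real_derivative a/L) (at y)" and mx: "((\<lambda>x. mn x y) has_real_derivative b/L) (at x)"
    using mn_deriv_right[OF xy] mn_deriv_left[OF xy] by (simp_all add: a_def b_def L_def)
  have ty: "((\<lambda>y. md x y) has_real_derivative a/L/P) (at y)" and tx: "((\<lambda>x. md x y) has_real_derivative b/L/P) (at x)"
    using md_deriv_right[OF xy P0] md_deriv_left[OF xy P0] by (simp_all add: a_def b_def L_def P_def)
  have Py: "((\<lambda>y. deriv g (md x y)) has_real_derivative P2 * (a/L/P)) (at y)"
    using P2 ty by (rule DERIV_chain2[where f = "deriv g" and g = "\<lambda>y. md x y"])
  have Px: "((\<lambda>x. deriv g (md x y)) has_real_derivative P2 * (b/L/P)) (at x)"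
    using P2 tx by (rule DERIV_chain2[where f = "deriv g" and g = "\<lambda>x. md x y"])
  have gy: "(g has_real_derivative q) (at y)" and gx: "(g has_real_derivative p) (at x)"
    using g_deriv xy by (simp_all add: p_def q_def)
  \<comment> \<open>\<open>mixed_relation\<close> requires a nonzero derivative at the mean point.
    Positivity near \<open>md x y\<close> makes \<open>?E\<close> vanish for all nearby end points,
    so both of its partial derivatives are zero.\<close>
  have posnear: "\<forall>\<^sub>F t in nhds (md x y). deriv g t > 0"
    using isCont_deriv[of "md x y"] m xy P
    by (auto simp: isCont_def tendsto_at_iff_tendsto_nhds P_def intro: order_tendstoD)
  have Ey: "((\<lambda>y. ?E x y) has_real_derivative
      4*((q - a/L) * b + (a/L - 0) * a) +
      ((4*((q - a/L - (a/L - 0)) * (s - r) + (a/L/P - 0 - (1 - a/L/P)) * (a - b))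
        - ((1 - 0) * (a + b) + (q - 0) * L)) * P + P2 * (a/L/P) * (4*((a - b) * (s - r)) - L * (a + b)))) (at y)"
  proof (rule DERIV_cong)
    show "((\<lambda>y. ?E x y) has_real_derivative
      4*((q - a/L) * (mn x y - g x) + (a/L - 0) * (g y - mn x y)) +
      ((4*((q - a/L - (a/L - 0)) * (md x y - x - (y - md x y)) + (a/L/P - 0 - (1 - a/L/P)) * (g y - mn x y - (mn x y - g x)))
        - ((1 - 0) * (g y - g x) + (q - 0) * (y - x))) * deriv g (md x y)
        + P2 * (a/L/P) * (4*((g y - mn x y - (mn x y - g x)) * (md x y - x - (y - md x y)))
      - (y - x) * (g y - g x)))) (at y)"
      by (intro DERIV_add DERIV_cmult DERIV_mult DERIV_diff DERIV_const DERIV_ident my ty gy Py)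
  qed (simp add: a_def b_def s_def r_def L_def P_def)
  have Ex: "((\<lambda>x. ?E x y) has_real_derivative
      4*((0 - b/L) * b + (b/L - p) * a) +
      ((4*((0 - b/L - (b/L - p)) * (s - r) + (b/L/P - 1 - (0 - b/L/P)) * (a - b))
        - ((0 - 1) * (a + b) + (0 - p) * L)) * P + P2 * (b/L/P) * (4*((a - b) * (s - r)) - L * (a + b)))) (at x)"
  proof (rule DERIV_cong)
    show "((\<lambda>x. ?E x y) has_real_derivative
      4*((0 - b/L) * (mn x y - g x) + (b/L - p) * (g y - mn x y)) +
      ((4*((0 - b/L - (b/L - p)) * (md x y - x - (y - md x y)) + (b/L/P - 1 - (0 - b/L/P)) * (g y - mn x y - (mn x y - g x)))
        - ((0 - 1) * (g y - g x) + (0 - p) * (y - x))) * deriv g (md x y)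
        + P2 * (b/L/P) * (4*((g y - mn x y - (mn x y - g x)) * (md x y - x - (y - md x y)))
      - (y - x) * (g y - g x)))) (at x)"
      by (intro DERIV_add DERIV_cmult DERIV_mult DERIV_diff DERIV_const DERIV_ident mx tx gx Px)
  qed (simp add: a_def b_def s_def r_def L_def P_def)
  have "\<forall>\<^sub>F y' in nhds y. ?E x y' = 0"
  proof -
    have "filterlim (md x) (nhds (md x y)) (nhds y)"
      using DERIV_isCont[OF ty] tendsto_at_iff_tendsto_nhds[of "\<lambda>y. md x y" y] by (simp add: isCont_def)
    from eventually_compose_filterlim[OF posnear this]
    have "\<forall>\<^sub>F z in nhds y. deriv g (md x z) > 0 \<and> z \<in> {x<..<hi}"
      using eventually_nhds_in_open[of "{x<..<hi}" y] xy by (intro eventually_conj) auto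
    then show ?thesis by (rule eventually_mono) (rule E0; use xy in auto)
  qed
  from DERIV_unique[OF Ey] DERIV_cong_ev[OF refl this refl] have Ey0: "4*((q - a/L) * b + (a/L - 0) * a) +
      ((4*((q - a/L - (a/L - 0)) * (s - r) + (a/L/P - 0 - (1 - a/L/P)) * (a - b))
        - ((1 - 0) * (a + b) + (q - 0) * L)) * P + P2 * (a/L/P) * (4*((a - b) * (s - r)) - L * (a + b))) = 0"
    using DERIV_const by blast
  have "\<forall>\<^sub>F x' in nhds x. ?E x' y = 0"
  proof -
    have "filterlim (\<lambda>x. md x y) (nhds (md x y)) (nhds x)"
      using DERIV_isCont[OF tx] tendsto_at_iff_tendsto_nhds[of "\<lambda>x. md x y" x] by (simp add: isCont_def)
    from eventually_compose_filterlim[OF posnear this]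
    have "\<forall>\<^sub>F z in nhds x. deriv g (md z y) > 0 \<and> z \<in> {lo<..<y}"
      using eventually_nhds_in_open[of "{lo<..<y}" x] xy by (intro eventually_conj) auto
    then show ?thesis by (rule eventually_mono) (rule E0; use xy in auto)
  qed
  from DERIV_unique[OF Ex] DERIV_cong_ev[OF refl this refl] have Ex0: "4*((0 - b/L) * b + (b/L - p) * a) +
      ((4*((0 - b/L - (b/L - p)) * (s - r) + (b/L/P - 1 - (0 - b/L/P)) * (a - b))
        - ((0 - 1) * (a + b) + (0 - p) * L)) * P + P2 * (b/L/P) * (4*((a - b) * (s - r)) - L * (a + b))) = 0"
    using DERIV_const by blast
  \<comment> \<open>The mean value has partial derivatives \<open>b/L\<close> in \<open>x\<close>
    and \<open>a/L\<close> in \<open>y\<close>, so it is stationary in the direction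
    \<open>(-a, b)\<close>. Accordingly \<open>b\<close> times the \<open>y\<close>-derivative minus
    \<open>a\<close> times the \<open>x\<close>-derivative loses every term with \<open>P2\<close>.
    Naming the reciprocals makes this a polynomial identity.\<close>
  define c where "c = 1/L"
  define k where "k = c/P"
  have c: "a/L = a*c" "b/L = b*c" "a*c/P = a*k" "b*c/P = b*k" by (simp_all add: c_def k_def)
  show ?thesis
  proof -
    have "4*(b*q*b + a*a*p) + (4*(b*q-a*p)*(s-r) + 4*(a-b)^2 - (a+b)^2 - L*(b*q+a*p)) * P
      = b * (4*((q - a*c) * b + (a*c - 0) * a) +
      ((4*((q - a*c - (a*c - 0)) * (s - r) + (a*k - 0 - (1 - a*k)) * (a - b))
        - ((1 - 0) * (a + b) + (q - 0) * L)) * P + P2 * (a*k) * (4*((a - b) * (s - r)) - L * (a + b))))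
      - a * (4*((0 - b*c) * b + (b*c - p) * a) +
      ((4*((0 - b*c - (b*c - p)) * (s - r) + (b*k - 1 - (0 - b*k)) * (a - b))
        - ((0 - 1) * (a + b) + (0 - p) * L)) * P + P2 * (b*k) * (4*((a - b) * (s - r)) - L * (a + b))))"
      by (simp add: algebra_simps power2_eq_square)
    then show ?thesis using Ex0 Ey0 unfolding c P_def[symmetric] L(2) by simp
  qed
qed

text \<open>Near \<open>z\<close> the derivative is almost constant by continuity, and by the mean
  value theorem so are the difference quotients over the parts of a short interval. Hence
  \<open>rigid_interval\<close> applies to every interval near \<open>z\<close> and equates the
  derivatives at its end points with that at its mean point.\<close>

lemma deriv_locally_constant:
  assumes z: "lo < z" "z < hi" and pos: "deriv g z > 0"
  obtains e where "e > 0" "\<And>x. \<bar>x - z\<bar> < e \<Longrightarrow> lo < x \<and> x < hi \<and> deriv g x = deriv g z"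
proof -
  define P0 where "P0 = deriv g z"
  \<comment> \<open>Two values within relative distance 1/20000 of \<open>P0\<close> have a ratio
    within 1/5000 of 1, the tolerance of \<open>rigid_interval\<close>.\<close>
  have "\<forall>\<^sub>F w in nhds z. dist (deriv g w) P0 < P0/20000"
    using isCont_deriv[OF z] pos tendsto_at_iff_tendsto_nhds[of "deriv g" z]
    by (intro tendstoD) (simp_all add: isCont_def P0_def)
  moreover have "\<forall>\<^sub>F w in nhds z. w \<in> {lo<..<hi}"
    using z by (intro eventually_nhds_in_open) auto
  ultimately have "\<forall>\<^sub>F w in nhds z. \<bar>deriv g w - P0\<bar> < P0/20000 \<and> w \<in> {lo<..<hi}"
    by eventually_elim (simp add: dist_real_def)
  then obtain e where e: "e > 0" "\<And>w. \<bar>w - z\<bar> < e \<Longrightarrow> \<bar>deriv g w - P0\<bar> < P0/20000 \<and> lo < w \<and> w < hi"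
    by (auto simp: eventually_nhds_metric dist_real_def)
  have P0: "P0 > 0" using pos by (simp add: P0_def)
  have bounds: "P0 * (19999/20000) < deriv g w" "deriv g w < P0 * (20001/20000)" if "\<bar>w - z\<bar> < e" for w
  proof -
    have "deriv g w - P0 < P0/20000" "- (deriv g w - P0) < P0/20000"
      using e(2)[OF that] by (simp_all only: abs_less_iff)
    then show "P0 * (19999/20000) < deriv g w" "deriv g w < P0 * (20001/20000)" by simp_all
  qed
  have ratio: "\<bar>deriv g u / deriv g w - 1\<bar> \<le> 1/5000" if u: "\<bar>u - z\<bar> < e" and w: "\<bar>w - z\<bar> < e" for u w
  proof -
    have "deriv g w > 0" using bounds[OF w] P0 by simp
    moreover have "\<bar>deriv g u - deriv g w\<bar> \<le> 1/5000 * deriv g w"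
      using bounds[OF w] bounds[OF u] P0 by (intro abs_leI) simp_all
    moreover from calculation(1) have "deriv g u / deriv g w - 1 = (deriv g u - deriv g w) / deriv g w"
      by (simp add: field_simps)
    ultimately show ?thesis by (simp add: divide_le_eq)
  qed
  have const: "deriv g x = deriv g y" if "x < y" "\<bar>x - z\<bar> < e" "\<bar>y - z\<bar> < e" for x y
  proof -
    have xy: "lo < x" "x < y" "y < hi" using e(2) that by auto
    have ball: "\<bar>w - z\<bar> < e" if "x \<le> w" "w \<le> y" for w using that \<open>\<bar>x - z\<bar> < e\<close> \<open>\<bar>y - z\<bar> < e\<close> by auto
    have pw: "deriv g w > 0" if "x \<le> w" "w \<le> y" for w
      using bounds[OF ball[OF that]] P0 by simp
    note m = md[OF xy]
    define t where "t = md x y"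
    have t: "x < t" "t < y" "g t = mn x y" using m by (simp_all add: t_def)
    have mvt: "\<exists>w. u < w \<and> w < v \<and> g v - g u = (v - u) * deriv g w" if "x \<le> u" "u < v" "v \<le> y" for u v
    proof -
      have "(g has_real_derivative deriv g w) (at w)" if "u \<le> w" "w \<le> v" for w
        using that \<open>x \<le> u\<close> \<open>v \<le> y\<close> xy by (intro g_deriv) auto
      from MVT2[OF \<open>u < v\<close> this] show ?thesis by blast
    qed
    obtain w1 where w1: "t < w1" "w1 < y" "g y - g t = (y - t) * deriv g w1" using mvt[of t y] t by auto
    obtain w2 where w2: "x < w2" "w2 < t" "g t - g x = (t - x) * deriv g w2" using mvt[of x t] t by auto
    obtain w3 where w3: "x < w3" "w3 < y" "g y - g x = (y - x) * deriv g w3" using mvt[of x y] xy by auto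
    have P: "deriv g t > 0" using pw t by simp
    have eqs: "g y - mn x y = (y - t) * deriv g w1" "mn x y - g x = (t - x) * deriv g w2"
      using w1 w2 t by simp_all
    have "(t - x) + (y - t) = y - x" "(g y - mn x y) + (mn x y - g x) = g y - g x" by simp_all
    note sums = this
    have ge: "deriv g u / deriv g t \<ge> 1 - 1/5000" if "x \<le> u" "u \<le> y" for u
      using abs_le_D2[OF ratio[of u t]] ball that t by simp
    have "deriv g x = deriv g t \<and> deriv g y = deriv g t"
    proof (rule conjI)
      have c1: "g y - mn x y > 0" "mn x y - g x > 0" "t - x > 0" "y - t > 0"
        unfolding eqs using t w1 w2 pw by (auto intro!: mult_pos_pos)
      have c2: "8 * (g y - mn x y) * (t - x) = ((t - x) + (y - t)) * ((g y - mn x y) + (mn x y - g x)) + ((t - x) + (y - t))^2 * deriv g y"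
        "8 * (mn x y - g x) * (y - t) = ((t - x) + (y - t)) * ((g y - mn x y) + (mn x y - g x)) + ((t - x) + (y - t))^2 * deriv g x"
        unfolding sums t_def using deriv_right[OF xy] deriv_left[OF xy] by simp_all
      have c3: "\<bar>(g y - mn x y) / (deriv g t * (y - t)) - 1\<bar> \<le> 1/5000"
         "\<bar>(mn x y - g x) / (deriv g t * (t - x)) - 1\<bar> \<le> 1/5000"
        unfolding eqs using ratio[of w1 t] ratio[of w2 t] ball w1 w2 t by (simp_all add: mult.commute)
      have c4: "((g y - mn x y) + (mn x y - g x)) / (deriv g t * ((t - x) + (y - t))) \<ge> 1 - 1/5000"
        unfolding sums w3(3) using ge[of w3] w3 xy by (simp add: mult.commute)
      have c5: "deriv g y / deriv g t \<ge> 1 - 1/5000" using ge[of y] xy by simp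
      have P': "deriv g (md x y) \<noteq> 0" using P by (simp add: t_def)
      note r = rigid_interval[OF c1 P c2 mixed_relation[OF xy P', folded t_def]
          mixed_relation_deriv[OF xy pw, folded t_def] c3 c4 c5]
      show "deriv g x = deriv g t" by (rule r(1))
      show "deriv g y = deriv g t" by (rule r(2))
    qed
    then show ?thesis by simp
  qed
  show ?thesis
  proof (rule that[OF e(1)])
    fix x assume x: "\<bar>x - z\<bar> < e"
    have z: "\<bar>z - z\<bar> < e" using e(1) by simp
    have "deriv g x = deriv g z"
    proof (cases x z rule: linorder_cases)
      case less show ?thesis by (rule const[OF less x z])
    next
      case equal then show ?thesis by simp
    next
      case greater show ?thesis by (rule const[OF greater z x, symmetric])
    qed
    then show "lo < x \<and> x < hi \<and> deriv g x = deriv g z" using e(2)[OF x] by blast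
  qed
qed

text \<open>Strict monotonicity and the mean value theorem give a point \<open>z\<close> with
  positive derivative. The set where \<open>deriv g\<close> takes this value is closed by continuity
  and open by \<open>deriv_locally_constant\<close>, hence the whole interval.\<close>

lemma affine: "\<exists>\<alpha> \<beta>. \<forall>x. lo < x \<longrightarrow> x < hi \<longrightarrow> g x = \<alpha> * x + \<beta>"
proof (cases "lo < hi")
  case False
  then have "\<forall>x. lo < x \<longrightarrow> x < hi \<longrightarrow> g x = 0 * x + 0" using order.strict_trans by blast
  then show ?thesis by blast
next
  case True
  obtain u where u: "lo < u" "u < hi" using dense[OF True] by blast
  obtain v where v: "u < v" "v < hi" using dense[OF u(2)] by blast
  have mvt: "\<exists>w. x < w \<and> w < y \<and> g y - g x = (y - x) * deriv g w" if "lo < x" "x < y" "y < hi" for x y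
  proof -
    have "(g has_real_derivative deriv g w) (at w)" if "x \<le> w" "w \<le> y" for w
      using that \<open>lo < x\<close> \<open>y < hi\<close> by (intro g_deriv) auto
    from MVT2[OF \<open>x < y\<close> this] show ?thesis by blast
  qed
  obtain z where z: "u < z" "z < v" "g v - g u = (v - u) * deriv g z" using mvt[OF u(1) v] by blast
  have "(v - u) * deriv g z > 0" using mono[of u v] u v z(3) by simp
  then have pos: "deriv g z > 0" using v by (simp add: zero_less_mult_iff)
  let ?S = "{lo<..<hi}" and ?T = "{x \<in> {lo<..<hi}. deriv g x = deriv g z}"
  have "closedin (top_of_set ?S) ?T"
    by (rule continuous_closedin_preimage_constant)
      (simp add: continuous_at_imp_continuous_on isCont_deriv)
  moreover have "open ?T"
  proof (rule openI)
    fix x assume x: "x \<in> ?T"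
    then obtain e where e: "e > 0" "\<And>w. \<bar>w - x\<bar> < e \<Longrightarrow> lo < w \<and> w < hi \<and> deriv g w = deriv g x"
    proof -
      have "lo < x" "x < hi" "deriv g x > 0" using x pos by simp_all
      then show ?thesis using deriv_locally_constant[of x] that by blast
    qed
    show "\<exists>e>0. ball x e \<subseteq> ?T"
    proof (intro exI conjI subsetI)
      fix w assume "w \<in> ball x e"
      then have "\<bar>w - x\<bar> < e" by (simp add: dist_real_def)
      then show "w \<in> ?T" using e(2)[of w] x by simp
    qed (rule e(1))
  qed
  then have "openin (top_of_set ?S) ?T" by (intro open_subset) auto
  moreover have "connected ?S" by simp
  ultimately have "?T = {} \<or> ?T = ?S" unfolding connected_clopen by blast
  moreover have "z \<in> ?T" using z u v by simp
  ultimately have TS: "?T = ?S" by blast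
  have c: "deriv g x = deriv g z" if "lo < x" "x < hi" for x
  proof -
    have "x \<in> ?T" unfolding TS using that by simp
    then show ?thesis by simp
  qed
  have step: "g y - g x = deriv g z * (y - x)" if xy: "lo < x" "x < y" "y < hi" for x y
  proof -
    obtain w where "x < w" "w < y" "g y - g x = (y - x) * deriv g w" using mvt[OF xy] by blast
    then show ?thesis using c[of w] xy by simp
  qed
  have "g x = deriv g z * x + (g u - deriv g z * u)" if "lo < x" "x < hi" for x
  proof (cases x u rule: linorder_cases)
    case less show ?thesis using step[OF that(1) less u(2)] by (simp add: algebra_simps)
  next
    case equal then show ?thesis by simp
  next
    case greater show ?thesis using step[OF u(1) greater that(2)] by (simp add: algebra_simps)
  qed
  then show ?thesis by blast
qed

end

section \<open>Vanishing interval integrals and midpoint convexity\<close>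

text \<open>When all interval integrals of \<open>h\<close> vanish, the error sum in Henstock's
  lemma is exactly the Riemann sum of \<open>\<bar>h\<bar>\<close>. So \<open>\<bar>h\<bar>\<close>
  has integral zero.\<close>

lemma AE_zero_if_integrals_zero:
  fixes h :: "real \<Rightarrow> real"
  assumes int: "h integrable_on {a..b}"
    and zero: "\<And>x y. a \<le> x \<Longrightarrow> x \<le> y \<Longrightarrow> y \<le> b \<Longrightarrow> integral {x..y} h = 0"
  shows "AE x in lebesgue. x \<in> {a..b} \<longrightarrow> h x = 0"
proof -
  have "((\<lambda>x. \<bar>h x\<bar>) has_integral 0) (cbox a b)"
    unfolding has_integral
  proof (intro allI impI)
    fix e :: real assume "e > 0"
    obtain \<gamma> where \<gamma>: "gauge \<gamma>" "\<And>p. \<lbrakk>p tagged_partial_division_of (cbox a b); \<gamma> fine p\<rbrakk> \<Longrightarrow>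
             sum (\<lambda>(x,k). norm (measure lborel k *\<^sub>R h x - integral k h)) p < e"
      using Henstock_lemma[of h a b e] int \<open>e > 0\<close> unfolding box_real by blast
    show "\<exists>\<gamma>. gauge \<gamma> \<and> (\<forall>\<D>. \<D> tagged_division_of cbox a b \<and> \<gamma> fine \<D> \<longrightarrow>
              norm ((\<Sum>(x, k)\<in>\<D>. measure lborel k *\<^sub>R \<bar>h x\<bar>) - 0) < e)"
    proof (intro exI conjI allI impI, rule \<gamma>(1), elim conjE)
      fix p assume p: "p tagged_division_of cbox a b" "\<gamma> fine p"
      have "(\<Sum>(x, k)\<in>p. measure lborel k *\<^sub>R \<bar>h x\<bar>) = (\<Sum>(x, k)\<in>p. norm (measure lborel k *\<^sub>R h x - integral k h))"
      proof (intro sum.cong refl, clarify)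
        fix x K assume xK: "(x, K) \<in> p"
        obtain u v where K: "K = cbox u v" "K \<subseteq> cbox a b" "x \<in> K"
          using tagged_division_ofD(2,3,4)[OF p(1) xK] by metis
        then have "u \<le> v" "a \<le> u" "v \<le> b" by simp_all
        then have "integral K h = 0" using zero[of u v] K(1) by simp
        then show "measure lborel K *\<^sub>R \<bar>h x\<bar> = norm (measure lborel K *\<^sub>R h x - integral K h)"
          by (simp add: abs_mult)
      qed
      moreover have "(\<Sum>(x, k)\<in>p. norm (measure lborel k *\<^sub>R h x - integral k h)) < e"
        using \<gamma>(2) p tagged_division_of_def by blast
      moreover have "(\<Sum>(x, k)\<in>p. norm (measure lborel k *\<^sub>R h x - integral k h)) \<ge> 0"
        by (intro sum_nonneg) auto
      ultimately show "norm ((\<Sum>(x, k)\<in>p. measure lborel k *\<^sub>R \<bar>h x\<bar>) - 0) < e" by simp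
    qed
  qed
  then have hi: "((\<lambda>x. \<bar>h x\<bar>) has_integral 0) {a..b}" by simp
  then have af: "(\<lambda>x. \<bar>h x\<bar>) absolutely_integrable_on {a..b}"
    by (intro nonnegative_absolutely_integrable_1) (auto simp: integrable_on_def)
  have "0 = (LINT x:{a..b}|lebesgue. \<bar>h x\<bar>)"
    using set_lebesgue_integral_eq_integral(2)[OF af] integral_unique[OF hi] by simp
  also have "\<dots> = 0 \<longleftrightarrow> (AE x in lebesgue. indicator {a..b} x *\<^sub>R \<bar>h x\<bar> = 0)"
    unfolding set_lebesgue_integral_def
    by (rule integral_nonneg_eq_0_iff_AE) (use af in \<open>auto simp: set_integrable_def\<close>)
  finally have "AE x in lebesgue. a \<le> x \<longrightarrow> x \<le> b \<longrightarrow> h x = 0" by (simp add: indicator_def)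
  then show ?thesis by eventually_elim simp
qed

text \<open>Between the end points of a chord, a strictly midpoint-convex function minus the chord cannot
  attain a positive maximum.\<close>

lemma strict_midpoint_convex_imp_convex:
  fixes G :: "real \<Rightarrow> real"
  assumes cont: "continuous_on {lo<..<hi} G"
    and mid: "\<And>x h. h > 0 \<Longrightarrow> lo < x - h \<Longrightarrow> x + h < hi \<Longrightarrow> 2 * G x < G (x - h) + G (x + h)"
  shows "convex_on {lo<..<hi} G"
proof (rule convex_on_linorderI)
  fix t x y :: real
  assume t: "0 < t" "t < 1" and xy: "x \<in> {lo<..<hi}" "y \<in> {lo<..<hi}" "x < y"
  define s where "s = (G y - G x) / (y - x)"
  define E where "E = (\<lambda>w. G w - (G x + s * (w - x)))"
  have "continuous_on {x..y} G" using cont by (rule continuous_on_subset) (use xy in auto)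
  then have "continuous_on {x..y} E" unfolding E_def by (intro continuous_intros)
  then obtain t0 where t0: "t0 \<in> {x..y}" "\<And>w. w \<in> {x..y} \<Longrightarrow> E w \<le> E t0"
    using continuous_attains_sup[of "{x..y}" E] xy(3) by auto
  have ends: "E x = 0" "E y = 0" using xy by (simp_all add: E_def s_def)
  have "E t0 \<le> 0"
  proof (rule ccontr)
    assume "\<not> E t0 \<le> 0"
    then have "t0 \<noteq> x" "t0 \<noteq> y" using ends by auto
    then have b: "x < t0" "t0 < y" using t0(1) by auto
    define h where "h = min (t0 - x) (y - t0)"
    have h: "h > 0" "x \<le> t0 - h" "t0 + h \<le> y" using b by (auto simp: h_def)
    have "2 * G t0 < G (t0 - h) + G (t0 + h)" using h xy by (intro mid) auto
    then have "2 * E t0 < E (t0 - h) + E (t0 + h)" unfolding E_def by (simp add: algebra_simps)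
    moreover have "E (t0 - h) \<le> E t0" "E (t0 + h) \<le> E t0" using h b by (auto intro!: t0(2))
    ultimately show False by linarith
  qed
  define w where "w = (1 - t) *\<^sub>R x + t *\<^sub>R y"
  have w: "w = x + t * (y - x)" by (simp add: w_def algebra_simps)
  have "t * (y - x) \<le> 1 * (y - x)" using t xy by (intro mult_right_mono) auto
  moreover have "0 \<le> t * (y - x)" using t xy by simp
  ultimately have "w \<in> {x..y}" unfolding w by simp
  then have "E w \<le> 0" using t0(2) \<open>E t0 \<le> 0\<close> by force
  then have "G w \<le> G x + s * (t * (y - x))" by (simp add: E_def w)
  also have "s * (t * (y - x)) = t * (G y - G x)" using xy by (simp add: s_def)
  finally show "G ((1 - t) *\<^sub>R x + t *\<^sub>R y) \<le> (1 - t) * G x + t * G y"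
    unfolding w_def by (simp add: algebra_simps)
qed simp

text \<open>Under bisection the increments of \<open>g\<close> telescope while the lengths are
  halved, so \<open>n\<close> bisections improve the bound by the factor \<open>2^n\<close>.\<close>

lemma dyadic_bound_imp_zero:
  fixes E g :: "real \<Rightarrow> real"
  assumes E: "\<And>x y. a \<le> x \<Longrightarrow> x < y \<Longrightarrow> y \<le> b \<Longrightarrow> \<bar>E y - E x\<bar> \<le> (g y - g x) * (y - x)"
    and xy: "a \<le> x" "x < y" "y \<le> b"
  shows "E y = E x"
proof -
  have "a \<le> x \<Longrightarrow> x < y \<Longrightarrow> y \<le> b \<Longrightarrow> \<bar>E y - E x\<bar> \<le> (g y - g x) * (y - x) / 2^n" for n :: nat and x y
  proof (induction n arbitrary: x y)
    case 0
    then show ?case using E[of x y] by simp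
  next
    case (Suc n)
    define w where "w = (x + y) / 2"
    have w: "x < w" "w < y" "w - x = (y - x)/2" "y - w = (y - x)/2"
      using Suc.prems by (auto simp: w_def field_simps)
    have "\<bar>E y - E x\<bar> \<le> \<bar>E w - E x\<bar> + \<bar>E y - E w\<bar>" by (rule order.trans[OF _ abs_triangle_ineq]) simp
    also have "\<dots> \<le> (g w - g x) * (w - x) / 2^n + (g y - g w) * (y - w) / 2^n"
    proof (rule add_mono)
      show "\<bar>E w - E x\<bar> \<le> (g w - g x) * (w - x) / 2^n"
        by (rule Suc.IH) (use Suc.prems w(1,2) in linarith)+
      show "\<bar>E y - E w\<bar> \<le> (g y - g w) * (y - w) / 2^n"
        by (rule Suc.IH) (use Suc.prems w(1,2) in linarith)+
    qed
    also have "\<dots> = (g y - g x) * (y - x) / 2^Suc n" unfolding w(3,4) by (simp add: field_simps)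
    finally show ?case .
  qed
  from this[OF xy] have b: "\<bar>E y - E x\<bar> \<le> (g y - g x) * (y - x) * (1/2)^n" for n :: nat
    by (simp add: power_divide)
  have "(\<lambda>n. (g y - g x) * (y - x) * (1/2)^n) \<longlonglongrightarrow> (g y - g x) * (y - x) * 0"
    by (intro tendsto_intros LIMSEQ_power_zero) simp
  then have "\<bar>E y - E x\<bar> \<le> (g y - g x) * (y - x) * 0"
    by (rule LIMSEQ_le_const) (intro exI[of _ 0] allI impI b)
  then show ?thesis by simp
qed

section \<open>Superadditive mean oscillation\<close>

locale local_integrable =
  fixes lo hi :: real and f :: "real \<Rightarrow> real"
  assumes abs_int: "\<And>x y. lo < x \<Longrightarrow> x \<le> y \<Longrightarrow> y < hi \<Longrightarrow> f absolutely_integrable_on {x..y}"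
begin

text \<open>Mean value and oscillation are rewritten as functions of the end points, with gauge
  integrals over closed intervals; \<open>mean_value_eq\<close> and \<open>osc_eq\<close> below
  identify them with the original notions.\<close>

definition integ :: "real \<Rightarrow> real \<Rightarrow> real" where "integ x y = integral {x..y} f"
definition mean :: "real \<Rightarrow> real \<Rightarrow> real" where "mean x y = integ x y / (y - x)"
definition dev :: "real \<Rightarrow> real \<Rightarrow> real \<Rightarrow> real" where "dev x y c = integral {x..y} (\<lambda>t. \<bar>f t - c\<bar>)"
definition osci :: "real \<Rightarrow> real \<Rightarrow> real" where "osci x y = dev x y (mean x y) / (y - x)"

lemma f_int: "lo < x \<Longrightarrow> x \<le> y \<Longrightarrow> y < hi \<Longrightarrow> f integrable_on {x..y}"
  using abs_int set_lebesgue_integral_eq_integral(1) by blast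

lemma dev_abs_int:
  assumes "lo < x" "x \<le> y" "y < hi"
  shows "(\<lambda>t. f t - c) absolutely_integrable_on {x..y}"
  using abs_int[OF assms] absolutely_integrable_on_const[of "{x..y}" c]
  by (intro set_integral_diff(1)) auto

lemma dev_int: "lo < x \<Longrightarrow> x \<le> y \<Longrightarrow> y < hi \<Longrightarrow> (\<lambda>t. \<bar>f t - c\<bar>) integrable_on {x..y}"
  using dev_abs_int[THEN set_integrable_abs] set_lebesgue_integral_eq_integral(1) by blast

lemma integ_add: "lo < x \<Longrightarrow> x \<le> y \<Longrightarrow> y \<le> z \<Longrightarrow> z < hi \<Longrightarrow> integ x y + integ y z = integ x z"
  unfolding integ_def by (rule Henstock_Kurzweil_Integration.integral_combine) (auto intro: f_int)

lemma dev_add: "lo < x \<Longrightarrow> x \<le> y \<Longrightarrow> y \<le> z \<Longrightarrow> z < hi \<Longrightarrow> dev x y c + dev y z c = dev x z c"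
  unfolding dev_def by (rule Henstock_Kurzweil_Integration.integral_combine) (auto intro: dev_int)

lemma dev_nonneg: "dev x y c \<ge> 0"
  unfolding dev_def
  by (cases "(\<lambda>t. \<bar>f t - c\<bar>) integrable_on {x..y}")
     (simp_all add: Henstock_Kurzweil_Integration.integral_nonneg not_integrable_integral)

lemma dev_change:
  assumes "lo < x" "x \<le> y" "y < hi"
  shows "dev x y c \<le> dev x y c' + \<bar>c - c'\<bar> * (y - x)"
proof -
  have "dev x y c \<le> integral {x..y} (\<lambda>t. \<bar>f t - c'\<bar> + \<bar>c - c'\<bar>)"
    unfolding dev_def using dev_int[OF assms]
    by (intro integral_le integrable_add integrable_const_ivl) auto
  also have "\<dots> = dev x y c' + \<bar>c - c'\<bar> * (y - x)"
    unfolding dev_def using dev_int[OF assms] assms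
    by (subst Henstock_Kurzweil_Integration.integral_add) (auto simp: integrable_const_ivl)
  finally show ?thesis .
qed

lemma dev_ge:
  assumes "lo < x" "x < y" "y < hi"
  shows "\<bar>mean x y - c\<bar> * (y - x) \<le> dev x y c"
proof -
  note a = assms(1) less_imp_le[OF assms(2)] assms(3)
  have "\<bar>integral {x..y} (\<lambda>t. f t - c)\<bar> \<le> dev x y c"
    unfolding dev_def real_norm_def[symmetric]
    using set_lebesgue_integral_eq_integral(1)[OF dev_abs_int[OF a, of c]] dev_int[OF a, of c]
    by (intro integral_norm_bound_integral) simp_all
  also have "integral {x..y} (\<lambda>t. f t - c) = integ x y - c * (y - x)"
    using f_int[OF a] assms
    by (subst Henstock_Kurzweil_Integration.integral_diff)
       (auto simp: integrable_const_ivl integ_def algebra_simps)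
  also have "\<dots> = (mean x y - c) * (y - x)"
    using assms(2) by (simp add: mean_def left_diff_distrib)
  finally show ?thesis using assms by (simp add: abs_mult)
qed

lemma osci_nonneg: "x < y \<Longrightarrow> osci x y \<ge> 0"
  unfolding osci_def using dev_nonneg by simp

lemma dev_mean: "x < y \<Longrightarrow> dev x y (mean x y) = osci x y * (y - x)"
  unfolding osci_def by simp

lemma mean_combine:
  assumes "lo < x" "x < y" "y < z" "z < hi"
  shows "mean x z * (z - x) = mean x y * (y - x) + mean y z * (z - y)"
  using integ_add[of x y z] assms by (simp add: mean_def)

text \<open>The mean over the whole interval is the midpoint of the means over the halves, at
  distance \<open>\<bar>d\<bar>/2\<close> from each. The triangle inequality then gives the upper
  estimate of the oscillation, and Jensen's inequality in the form \<open>dev_ge\<close> the lower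
  one.\<close>

lemma osci_halves:
  assumes "lo < x - h" "h > 0" "x + h < hi"
  defines "d \<equiv> mean x (x+h) - mean (x-h) x"
  shows "2 * osci (x-h) (x+h) \<le> osci (x-h) x + osci x (x+h) + \<bar>d\<bar>"
    and "\<bar>d\<bar> \<le> 2 * osci (x-h) (x+h)"
proof -
  define m1 m2 M where "m1 = mean (x-h) x" and "m2 = mean x (x+h)" and "M = mean (x-h) (x+h)"
  have M: "M = (m1 + m2) / 2"
  proof -
    have "h * (2 * M - (m1 + m2)) = 0"
      using mean_combine[of "x-h" x "x+h"] assms by (simp add: M_def m1_def m2_def algebra_simps)
    then show ?thesis using assms(2) by simp
  qed
  have d: "\<bar>M - m1\<bar> = \<bar>d\<bar>/2" "\<bar>M - m2\<bar> = \<bar>d\<bar>/2" "\<bar>m1 - M\<bar> = \<bar>d\<bar>/2" "\<bar>m2 - M\<bar> = \<bar>d\<bar>/2"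
    unfolding M d_def m1_def[symmetric] m2_def[symmetric] by (auto simp: abs_if field_simps)
  have osc: "osci (x-h) (x+h) * (2*h) = dev (x-h) x M + dev x (x+h) M"
    using dev_add[of "x-h" x "x+h" M] dev_mean[of "x-h" "x+h"] assms by (simp add: M_def)
  have "dev (x-h) x M \<le> osci (x-h) x * h + \<bar>d\<bar>/2*h" "dev x (x+h) M \<le> osci x (x+h) * h + \<bar>d\<bar>/2*h"
  proof -
    have "dev (x-h) x M \<le> osci (x-h) x * h + \<bar>M - m1\<bar>*h" "dev x (x+h) M \<le> osci x (x+h) * h + \<bar>M - m2\<bar>*h"
      using dev_change[of "x-h" x M m1] dev_change[of x "x+h" M m2] assms(1-3) dev_mean[of "x-h" x] dev_mean[of x "x+h"]
      by (simp_all add: m1_def m2_def)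
    then show "dev (x-h) x M \<le> osci (x-h) x * h + \<bar>d\<bar>/2*h" "dev x (x+h) M \<le> osci x (x+h) * h + \<bar>d\<bar>/2*h"
      unfolding d .
  qed
  with osc have "2 * osci (x-h) (x+h) * h \<le> (osci (x-h) x + osci x (x+h) + \<bar>d\<bar>) * h"
    by (simp add: algebra_simps)
  then show "2 * osci (x-h) (x+h) \<le> osci (x-h) x + osci x (x+h) + \<bar>d\<bar>"
    using assms(2) by (simp only: mult_le_cancel_right)
  have "\<bar>d\<bar>/2*h \<le> dev (x-h) x M" "\<bar>d\<bar>/2*h \<le> dev x (x+h) M"
    using dev_ge[of "x-h" x M] dev_ge[of x "x+h" M] assms(1-3)
    unfolding m1_def[symmetric] m2_def[symmetric] d by simp_all
  with osc have "\<bar>d\<bar> * h \<le> 2 * osci (x-h) (x+h) * h" by (simp add: algebra_simps)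
  then show "\<bar>d\<bar> \<le> 2 * osci (x-h) (x+h)" using assms(2) by (simp only: mult_le_cancel_right)
qed

end

text \<open>Here \<open>k\<close> is the length of an interval where the function is constant and
  \<open>e\<close> that of the added piece; \<open>M\<close> and \<open>m2\<close> are the means
  over the union and the added piece, relative to that constant. The assumptions give
  \<open>D \<le> 2 * \<bar>m2\<bar> * e / (k + e)\<close>. Since \<open>k\<close> is at least
  \<open>9 * e\<close>, the fraction \<open>e / (k + e)\<close> is at most 1/10, and
  \<open>low\<close> yields \<open>D \<le> 4 * D / 10\<close>.\<close>

lemma extend_bound:
  fixes m m2 e k O2 O1 D1 D2 D :: real
  assumes "e > 0" "k \<ge> 9 * e" and M: "M * (k + e) = m2 * e" and D1: "D1 \<le> \<bar>M\<bar> * k"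
    and D2: "D2 \<le> O2 * e + \<bar>M - m2\<bar> * e" and D: "D * (k + e) = D1 + D2" and "O2 \<le> D"
    and low: "\<bar>m2\<bar> \<le> 2 * D"
  shows "D \<le> 0"
proof -
  have ke: "k + e > 0" "k > 0" using assms by auto
  have M': "M = m2 * e / (k + e)" using M ke by (simp add: field_simps)
  have "M - m2 = - (m2 * k / (k + e))" unfolding M' using ke by (simp add: field_simps)
  then have a: "\<bar>M - m2\<bar> * e = \<bar>m2\<bar> * e * k / (k+e)" using ke assms(1) by (simp add: abs_mult)
  have b: "\<bar>M\<bar> * k = \<bar>m2\<bar> * e * k / (k+e)" unfolding M' using ke assms(1) by (simp add: abs_mult)
  have "O2 * e \<le> D * e" using assms by simp
  then have "D * (k + e) \<le> D * e + 2 * (\<bar>m2\<bar> * e * k / (k+e))" using D D1 D2 a b by simp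
  then have "D * k \<le> 2 * \<bar>m2\<bar> * e / (k+e) * k" by (simp add: algebra_simps)
  then have 1: "D \<le> 2 * \<bar>m2\<bar> * e / (k+e)" using ke(2) by (simp only: mult_le_cancel_right)
  have "2 * \<bar>m2\<bar> * e / (k+e) \<le> 2 * \<bar>m2\<bar> / 10"
    using mult_right_mono[OF assms(2) abs_ge_zero[of m2]] ke by (simp add: field_simps)
  with 1 low have "D \<le> 4 * D / 10" by simp
  then show ?thesis by simp
qed

section \<open>Superadditivity and the spreading of intervals of constancy\<close>

locale superadditive_osc = local_integrable +
  assumes super: "\<And>x y z. lo < x \<Longrightarrow> x < y \<Longrightarrow> y < z \<Longrightarrow> z < hi \<Longrightarrow> osci x y + osci y z \<le> osci x z"
begin

lemma osci_mono:
  assumes "lo < x" "x \<le> x'" "x' < y'" "y' \<le> y" "y < hi"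
  shows "osci x' y' \<le> osci x y"
proof -
  have "osci x' y' \<le> osci x y'"
  proof (cases "x = x'")
    case False
    then show ?thesis using super[of x x' y'] osci_nonneg[of x x'] assms by simp
  qed simp
  also have "\<dots> \<le> osci x y"
  proof (cases "y = y'")
    case False
    then show ?thesis using super[of x y' y] osci_nonneg[of y' y] assms by simp
  qed simp
  finally show ?thesis .
qed

text \<open>By superadditivity twice the left side is at most \<open>2 * osci (x-h) (x+h)\<close>,
  which \<open>osci_halves\<close> bounds by the left side plus the jump of the means.\<close>

lemma osci_le_jump:
  assumes "lo < x - h" "h > 0" "x + h < hi"
  shows "osci (x-h) x + osci x (x+h) \<le> \<bar>mean x (x+h) - mean (x-h) x\<bar>"
proof -
  have "osci (x-h) x + osci x (x+h) \<le> osci (x-h) (x+h)" using assms by (intro super) auto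
  with osci_halves(1)[OF assms] show ?thesis by linarith
qed

lemma osci_zero_mean:
  assumes "lo < x" "x \<le> x'" "x' < y'" "y' \<le> y" "y < hi" and "osci x y = 0"
  shows "mean x' y' = mean x y"
proof -
  have "dev x y (mean x y) = 0" using dev_mean[of x y] assms by simp
  moreover have "dev x' y' (mean x y) \<le> dev x y (mean x y)"
    using dev_add[of x x' y "mean x y"] dev_add[of x' y' y "mean x y"]
      dev_nonneg[of x x' "mean x y"] dev_nonneg[of y' y "mean x y"] assms by simp
  ultimately have "\<bar>mean x' y' - mean x y\<bar> * (y' - x') \<le> 0" using dev_ge[of x' y' "mean x y"] assms by simp
  then show ?thesis using assms by (simp add: mult_le_0_iff)
qed

text \<open>If the oscillation vanishes on an interval, it vanishes on the interval enlarged by a ninth of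
  its length: otherwise the oscillation over the unbalanced interval would be smaller than over the
  symmetric interval around the transition point.\<close>

lemma osci_zero_extend_right:
  assumes "lo < x" "x < y" "e > 0" "9 * e \<le> y - x" "y + e < hi" and z: "osci x y = 0"
  shows "osci x (y + e) = 0"
proof -
  define c where "c = mean x y"
  have m1: "mean (y - e) y = c" unfolding c_def using assms by (intro osci_zero_mean) auto
  define m2 where "m2 = mean y (y + e) - c"
  define M where "M = mean x (y + e) - c"
  have "osci x (y + e) \<le> 0"
  proof (rule extend_bound)
    show "M * ((y - x) + e) = m2 * e"
      using mean_combine[of x y "y+e"] assms by (simp add: M_def m2_def c_def algebra_simps)
    show "dev x y (mean x (y+e)) \<le> \<bar>M\<bar> * (y - x)"
      using dev_change[of x y "mean x (y+e)" c] dev_mean[of x y] assms by (simp add: M_def c_def)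
    show "dev y (y + e) (mean x (y+e)) \<le> osci y (y+e) * e + \<bar>M - m2\<bar> * e"
      using dev_change[of y "y+e" "mean x (y+e)" "mean y (y+e)"] dev_mean[of y "y+e"] assms
      by (simp add: M_def m2_def)
    show "osci x (y + e) * ((y - x) + e) = dev x y (mean x (y+e)) + dev y (y + e) (mean x (y+e))"
      using dev_add[of x y "y+e" "mean x (y+e)"] dev_mean[of x "y+e"] assms by (simp add: algebra_simps)
    show "osci y (y+e) \<le> osci x (y+e)" using assms by (intro osci_mono) auto
    show "\<bar>m2\<bar> \<le> 2 * osci x (y+e)"
      using osci_halves(2)[of y e] osci_mono[of x "y-e" "y+e" "y+e"] assms m1 by (simp add: m2_def)
  qed (use assms in auto)
  then show ?thesis using osci_nonneg[of x "y+e"] assms by simp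
qed

lemma osci_zero_extend_left:
  assumes "lo < x - e" "x < y" "e > 0" "9 * e \<le> y - x" "y < hi" and z: "osci x y = 0"
  shows "osci (x - e) y = 0"
proof -
  define c where "c = mean x y"
  have m1: "mean x (x + e) = c" unfolding c_def using assms by (intro osci_zero_mean) auto
  define m2 where "m2 = mean (x - e) x - c"
  define M where "M = mean (x - e) y - c"
  have "osci (x - e) y \<le> 0"
  proof (rule extend_bound)
    show "M * ((y - x) + e) = m2 * e"
      using mean_combine[of "x-e" x y] assms by (simp add: M_def m2_def c_def algebra_simps)
    show "dev x y (mean (x-e) y) \<le> \<bar>M\<bar> * (y - x)"
      using dev_change[of x y "mean (x-e) y" c] dev_mean[of x y] assms by (simp add: M_def c_def)
    show "dev (x-e) x (mean (x-e) y) \<le> osci (x-e) x * e + \<bar>M - m2\<bar> * e"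
      using dev_change[of "x-e" x "mean (x-e) y" "mean (x-e) x"] dev_mean[of "x-e" x] assms
      by (simp add: M_def m2_def)
    show "osci (x - e) y * ((y - x) + e) = dev x y (mean (x-e) y) + dev (x-e) x (mean (x-e) y)"
      using dev_add[of "x-e" x y "mean (x-e) y"] dev_mean[of "x-e" y] assms by (simp add: algebra_simps)
    show "osci (x-e) x \<le> osci (x-e) y" using assms by (intro osci_mono) auto
    have "\<bar>mean x (x + e) - mean (x - e) x\<bar> \<le> 2 * osci (x-e) y"
      using osci_halves(2)[of x e] osci_mono[of "x-e" "x-e" "x+e" y] assms by simp
    then show "\<bar>m2\<bar> \<le> 2 * osci (x-e) y" unfolding m1 m2_def by (simp add: abs_minus_commute)
  qed (use assms in auto)
  then show ?thesis using osci_nonneg[of "x-e" y] assms by simp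
qed

text \<open>Each extension step passes from length \<open>9 * e\<close> to length
  \<open>10 * e\<close>; powers of 10/9 eventually exceed any given ratio of lengths.\<close>

lemma osci_zero_right:
  assumes "lo < x" "x < y" "y < hi" "osci x y = 0" "x < w" "w < hi"
  shows "osci x w = 0"
proof -
  have *: "x < w \<Longrightarrow> w < hi \<Longrightarrow> w - x \<le> (10/9)^n * (y - x) \<Longrightarrow> osci x w = 0" for n :: nat and w
  proof (induction n arbitrary: w)
    case 0
    then have "osci x w \<le> osci x y" using assms(1-3) by (intro osci_mono) auto
    then show ?case using osci_nonneg[of x w] 0 assms(4) by simp
  next
    case (Suc n)
    define e where "e = (w - x) / 10"
    have e: "e > 0" "w = x + 10 * e" using Suc.prems by (simp_all add: e_def field_simps)
    have "w - e - x \<le> (10/9)^n * (y - x)" using Suc.prems(3) e(2) by (simp add: mult.commute)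
    then have "osci x (w - e) = 0" using Suc e by simp
    then have "osci x ((w - e) + e) = 0"
      using e Suc.prems(2) assms(1) by (intro osci_zero_extend_right) auto
    then show ?case by simp
  qed
  obtain n :: nat where "(w - x) / (y - x) < (10/9)^n" using real_arch_pow[of "10/9"] by auto
  then have "w - x \<le> (10/9)^n * (y - x)" using assms(2) by (simp add: field_simps)
  then show ?thesis using * assms by blast
qed

lemma osci_zero_left:
  assumes "lo < x" "x < y" "y < hi" "osci x y = 0" "lo < w" "w < y"
  shows "osci w y = 0"
proof -
  have *: "lo < w \<Longrightarrow> w < y \<Longrightarrow> y - w \<le> (10/9)^n * (y - x) \<Longrightarrow> osci w y = 0" for n :: nat and w
  proof (induction n arbitrary: w)
    case 0
    then have "osci w y \<le> osci x y" using assms(1-3) by (intro osci_mono) auto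
    then show ?case using osci_nonneg[of w y] 0 assms(4) by simp
  next
    case (Suc n)
    define e where "e = (y - w) / 10"
    have e: "e > 0" "w = y - 10 * e" using Suc.prems by (simp_all add: e_def field_simps)
    have "y - (w + e) \<le> (10/9)^n * (y - x)" using Suc.prems(3) e(2) by (simp add: mult.commute)
    then have "osci (w + e) y = 0" using Suc e by simp
    then have "osci ((w + e) - e) y = 0"
      using e Suc.prems(1) assms(3) by (intro osci_zero_extend_left) auto
    then show ?case by simp
  qed
  obtain n :: nat where "(y - w) / (y - x) < (10/9)^n" using real_arch_pow[of "10/9"] by auto
  then have "y - w \<le> (10/9)^n * (y - x)" using assms(2) by (simp add: field_simps)
  then show ?thesis using * assms by blast
qed

text \<open>The interval of zero oscillation is enlarged, first to the right and then to the left,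
  until it also contains \<open>{u..v}\<close>; inside it all means agree.\<close>

lemma mean_constant:
  assumes "lo < x" "x < y" "y < hi" "osci x y = 0"
  obtains c where "\<And>u v. lo < u \<Longrightarrow> u < v \<Longrightarrow> v < hi \<Longrightarrow> mean u v = c"
proof (rule that)
  fix u v assume uv: "lo < u" "u < v" "v < hi"
  define l r where "l = min u x" and "r = max v y"
  have b: "lo < l" "l \<le> x" "l \<le> u" "y \<le> r" "v \<le> r" "r < hi"
    using uv assms by (auto simp: l_def r_def)
  have "osci x r = 0" using osci_zero_right[OF assms(1-4)] b assms by simp
  then have z: "osci l r = 0" using osci_zero_left[of x r l] b assms by simp
  have "mean u v = mean l r" "mean x y = mean l r"
    using uv b z assms by (auto intro!: osci_zero_mean)
  then show "mean u v = mean x y" by simp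
qed

end

section \<open>A primitive and the sign of its second differences\<close>

context local_integrable
begin

text \<open>The primitive that vanishes at the midpoint. The case distinction supplies the sign,
  since \<open>integ c x\<close> is zero rather than \<open>- integ x c\<close> for
  \<open>x < c\<close>.\<close>

definition prim :: "real \<Rightarrow> real" where
  "prim x = (let c = (lo + hi) / 2 in if c \<le> x then integ c x else - integ x c)"

lemma prim_diff:
  assumes "lo < x" "x \<le> y" "y < hi"
  shows "prim y - prim x = integ x y"
proof -
  define c where "c = (lo + hi) / 2"
  have c: "lo < c" "c < hi" using assms by (auto simp: c_def)
  have p: "prim z = (if c \<le> z then integ c z else - integ z c)" for z
    by (simp add: prim_def c_def)
  consider "c \<le> x" | "x < c" "c \<le> y" | "y < c" using assms by linarith
  then show ?thesis
  proof cases
    case 1 then show ?thesis using integ_add[of c x y] assms c by (simp add: p)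
  next
    case 2 then show ?thesis using integ_add[of x c y] assms c by (simp add: p)
  next
    case 3 then show ?thesis using integ_add[of x y c] assms c by (simp add: p)
  qed
qed

lemma mean_prim: "lo < x \<Longrightarrow> x < y \<Longrightarrow> y < hi \<Longrightarrow> mean x y = (prim y - prim x) / (y - x)"
  by (simp add: mean_def prim_diff)

lemma continuous_prim: "continuous_on {lo<..<hi} prim"
proof (rule continuous_at_imp_continuous_on, rule ballI)
  fix x assume x: "x \<in> {lo<..<hi}"
  obtain u where u: "lo < u" "u < x" using dense x by auto
  obtain v where v: "x < v" "v < hi" using dense x by auto
  have "continuous_on {u..v} (\<lambda>z. prim u + integral {u..z} f)"
    using u v by (intro continuous_intros indefinite_integral_continuous_1 f_int) auto
  then have "continuous_on {u..v} prim"
  proof (rule continuous_on_eq)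
    fix z assume "z \<in> {u..v}"
    then show "prim u + integral {u..z} f = prim z" using prim_diff[of u z] u v by (simp add: integ_def)
  qed
  then show "isCont prim x" using u v by (intro continuous_on_interior[of "{u..v}"]) simp_all
qed

end

definition second_difference :: "(real \<Rightarrow> real) \<Rightarrow> real \<Rightarrow> real \<Rightarrow> real" where
  "second_difference G x h = G (x + h) - 2 * G x + G (x - h)"

text \<open>The admissible pairs \<open>(x, h)\<close> form an intersection of three half-planes, a
  convex and hence connected set. A continuous function without zeros has constant sign on
  it.\<close>

lemma second_difference_sign:
  fixes G :: "real \<Rightarrow> real"
  assumes cont: "continuous_on {lo<..<hi} G"
    and nz: "\<And>x h. h > 0 \<Longrightarrow> lo < x - h \<Longrightarrow> x + h < hi \<Longrightarrow> second_difference G x h \<noteq> 0"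
  shows "(\<forall>x h. h > 0 \<longrightarrow> lo < x - h \<longrightarrow> x + h < hi \<longrightarrow> second_difference G x h > 0) \<or>
    (\<forall>x h. h > 0 \<longrightarrow> lo < x - h \<longrightarrow> x + h < hi \<longrightarrow> second_difference G x h < 0)"
proof -
  define S :: "(real \<times> real) set" where
    "S = {p. inner (0, 1) p > 0} \<inter> {p. inner (1, -1) p > lo} \<inter> {p. inner (1, 1) p < hi}"
  have S: "(x, h) \<in> S \<longleftrightarrow> h > 0 \<and> lo < x - h \<and> x + h < hi" for x h
    by (auto simp: S_def inner_prod_def)
  define D where "D = (\<lambda>p. second_difference G (fst p) (snd p))"
  have "convex S" unfolding S_def
    by (intro convex_Int convex_halfspace_gt convex_halfspace_lt)
  then have "connected S" by (rule convex_connected)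
  have cG: "continuous_on S (\<lambda>p. G (u p))" if "continuous_on S u" "u ` S \<subseteq> {lo<..<hi}" for u
    using cont that by (rule continuous_on_compose2)
  have "continuous_on S D"
    unfolding D_def second_difference_def
    by (intro continuous_on_add continuous_on_diff continuous_on_mult_left cG
        continuous_on_fst continuous_on_snd continuous_on_id) (auto simp: S)
  then have conn: "connected (D ` S)" using \<open>connected S\<close> by (rule connected_continuous_image)
  have nz': "D p \<noteq> 0" if "p \<in> S" for p
    using nz that S[of "fst p" "snd p"] by (simp add: D_def)
  have False if "p \<in> S" "q \<in> S" "D p < 0" "D q > 0" for p q
  proof -
    have "{D p..D q} \<subseteq> D ` S"
      by (rule connected_contains_Icc[OF conn]) (use that in auto)
    moreover have "0 \<in> {D p..D q}" using that by simp
    ultimately obtain r where "r \<in> S" "D r = 0" by force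
    then show False using nz' by blast
  qed
  then consider "\<forall>p\<in>S. D p > 0" | "\<forall>p\<in>S. D p < 0" using nz' by (metis linorder_neqE_linordered_idom)
  then show ?thesis
  proof cases
    case 1
    have "second_difference G x h > 0" if "h > 0" "lo < x - h" "x + h < hi" for x h
      using bspec[OF 1, of "(x, h)"] that S by (simp add: D_def)
    then show ?thesis by blast
  next
    case 2
    have "second_difference G x h < 0" if "h > 0" "lo < x - h" "x + h < hi" for x h
      using bspec[OF 2, of "(x, h)"] that S by (simp add: D_def)
    then show ?thesis by blast
  qed
qed

lemma (in local_integrable) second_difference_prim:
  assumes "h > 0" "lo < x - h" "x + h < hi"
  shows "second_difference prim x h = h * (mean x (x + h) - mean (x - h) x)"
  using mean_prim[of x "x+h"] mean_prim[of "x-h" x] assms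
  by (simp add: second_difference_def field_simps)

text \<open>If the oscillation vanishes on some interval, constancy spreads everywhere. Otherwise
  \<open>osci_le_jump\<close> keeps the means over neighbouring halves apart, so no second
  difference is zero.\<close>

lemma (in superadditive_osc) trichotomy:
  obtains (const) c where "\<And>u v. lo < u \<Longrightarrow> u < v \<Longrightarrow> v < hi \<Longrightarrow> mean u v = c"
  | (pos) "\<And>x h. h > 0 \<Longrightarrow> lo < x - h \<Longrightarrow> x + h < hi \<Longrightarrow> second_difference prim x h > 0"
  | (neg) "\<And>x h. h > 0 \<Longrightarrow> lo < x - h \<Longrightarrow> x + h < hi \<Longrightarrow> second_difference prim x h < 0"
proof (cases "\<exists>x y. lo < x \<and> x < y \<and> y < hi \<and> osci x y = 0")
  case True
  then obtain x y where "lo < x" "x < y" "y < hi" "osci x y = 0" by blast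
  from mean_constant[OF this] const show ?thesis by blast
next
  case False
  have "second_difference prim x h \<noteq> 0" if h: "h > 0" "lo < x - h" "x + h < hi" for x h
  proof -
    have "osci (x-h) x \<noteq> 0" using False h by force
    then have "osci (x-h) x > 0" using osci_nonneg[of "x-h" x] h by simp
    moreover have "osci x (x+h) \<ge> 0" using osci_nonneg h by simp
    ultimately have "mean x (x+h) - mean (x-h) x \<noteq> 0" using osci_le_jump[OF h(2,1,3)] by force
    then show ?thesis using second_difference_prim[OF h] h by simp
  qed
  from second_difference_sign[OF continuous_prim this] pos neg show ?thesis by blast
qed

section \<open>The increasing case\<close>

text \<open>The bound \<open>upper\<close> is what remains of the total variation of a monotone
  function. It ranges over all monotone representatives because the relevant one, \<open>g\<close>,
  is constructed only afterwards from the primitive.\<close>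

locale increasing_osc = superadditive_osc +
  assumes pos: "\<And>x h. h > 0 \<Longrightarrow> lo < x - h \<Longrightarrow> x + h < hi \<Longrightarrow> second_difference prim x h > 0"
    and upper: "\<And>g x y. lo < x \<Longrightarrow> x < y \<Longrightarrow> y < hi \<Longrightarrow> mono_on {x..y} g \<Longrightarrow>
      (AE t in lebesgue. t \<in> {x..y} \<longrightarrow> f t = g t) \<Longrightarrow> 4 * osci x y \<le> g y - g x"
begin

text \<open>The right derivative of the convex function \<open>prim\<close>, as the infimum of the
  slopes of chords to the right.\<close>

definition g :: "real \<Rightarrow> real" where
  "g x = Inf ((\<lambda>t. (prim x - prim t) / (x - t)) ` ({x<..} \<inter> {lo<..<hi}))"

lemma subgradient:
  assumes "lo < x" "x < hi" "lo < y" "y < hi"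
  shows "prim x + g x * (y - x) \<le> prim y"
proof -
  have "convex_on {lo<..<hi} prim"
  proof (rule strict_midpoint_convex_imp_convex[OF continuous_prim])
    fix x h assume h: "h > 0" "lo < x - h" "x + h < hi"
    show "2 * prim x < prim (x - h) + prim (x + h)"
      using pos[OF h] by (simp add: second_difference_def)
  qed
  then show ?thesis unfolding g_def by (rule convex_le_Inf_differential) (use assms in simp_all)
qed

lemma slope_bounds:
  assumes "lo < x" "x < y" "y < hi"
  shows "g x * (y - x) \<le> prim y - prim x" "prim y - prim x \<le> g y * (y - x)"
  using subgradient[of x y] subgradient[of y x] assms by (simp_all add: algebra_simps)

lemma mean_bounds:
  assumes "lo < x" "x < y" "y < hi"
  shows "g x \<le> mean x y" "mean x y \<le> g y"
  using slope_bounds[OF assms] assms by (simp_all add: mean_prim le_divide_eq divide_le_eq)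

lemma g_less:
  assumes "lo < x" "x < y" "y < hi"
  shows "g x < g y"
proof -
  define w h where "w = (x + y) / 2" and "h = (y - x) / 2"
  have w: "x = w - h" "y = w + h" "h > 0" using assms by (auto simp: w_def h_def field_simps)
  have "0 < second_difference prim w h" using assms w by (intro pos) auto
  also have "\<dots> = h * (mean w (w + h) - mean (w - h) w)"
    using assms w by (intro second_difference_prim) auto
  finally have "mean (w - h) w < mean w (w + h)" using w(3) by (simp add: zero_less_mult_iff)
  moreover have "g x \<le> mean (w - h) w" "mean w (w + h) \<le> g y"
    unfolding w(1,2) using w assms by (auto intro!: mean_bounds)
  ultimately show ?thesis by linarith
qed

lemma g_le: "lo < x \<Longrightarrow> x \<le> y \<Longrightarrow> y < hi \<Longrightarrow> g x \<le> g y"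
  using g_less[of x y] by (cases "x = y") auto

lemma g_mono_on: "lo < x \<Longrightarrow> y < hi \<Longrightarrow> mono_on {x..y} g"
  by (rule mono_onI) (auto intro!: g_le)

lemma g_int: "lo < x \<Longrightarrow> y < hi \<Longrightarrow> g integrable_on {x..y}"
  by (intro integrable_on_mono_on g_mono_on)

text \<open>On every subinterval the increments of \<open>prim\<close> and of the integral of
  \<open>g\<close> both lie between \<open>g u * (v - u)\<close> and \<open>g v * (v - u)\<close>,
  so their difference satisfies the hypothesis of \<open>dyadic_bound_imp_zero\<close>.\<close>

lemma integral_g:
  assumes "lo < x" "x \<le> y" "y < hi"
  shows "integral {x..y} g = prim y - prim x"
proof (cases "x = y")
  case False
  define E where "E z = prim z - integral {x..z} g" for z
  have "E y = E x"
  proof (rule dyadic_bound_imp_zero[where E = E and a = x and b = y and g = g])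
    fix u v assume uv: "x \<le> u" "u < v" "v \<le> y"
    have "integral {x..u} g + integral {u..v} g = integral {x..v} g"
      using uv assms by (intro Henstock_Kurzweil_Integration.integral_combine g_int) auto
    then have E: "E v - E u = (prim v - prim u) - integral {u..v} g" by (simp add: E_def)
    have i: "g integrable_on {u..v}" using uv assms by (intro g_int) auto
    have "integral {u..v} (\<lambda>_. g u) \<le> integral {u..v} g"
      by (rule integral_le[OF integrable_const_ivl i]) (use uv assms in \<open>auto intro!: g_le\<close>)
    moreover have "integral {u..v} g \<le> integral {u..v} (\<lambda>_. g v)"
      by (rule integral_le[OF i integrable_const_ivl]) (use uv assms in \<open>auto intro!: g_le\<close>)
    ultimately have "g u * (v - u) \<le> integral {u..v} g" "integral {u..v} g \<le> g v * (v - u)"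
      using uv by (simp_all add: mult.commute[of "v - u"])
    moreover have "g u * (v - u) \<le> prim v - prim u" "prim v - prim u \<le> g v * (v - u)"
      using slope_bounds[of u v] uv assms by simp_all
    ultimately have "\<bar>E v - E u\<bar> \<le> g v * (v - u) - g u * (v - u)" unfolding E by linarith
    then show "\<bar>E v - E u\<bar> \<le> (g v - g u) * (v - u)" by (simp add: algebra_simps)
  qed (use assms False in auto)
  then show ?thesis by (simp add: E_def)
qed simp

lemma f_eq_g:
  assumes "lo < x" "x \<le> y" "y < hi"
  shows "AE t in lebesgue. t \<in> {x..y} \<longrightarrow> f t = g t"
proof -
  have "AE t in lebesgue. t \<in> {x..y} \<longrightarrow> f t - g t = 0"
  proof (rule AE_zero_if_integrals_zero)
    show "(\<lambda>t. f t - g t) integrable_on {x..y}"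
      using assms by (intro integrable_diff f_int g_int) auto
    fix u v assume uv: "x \<le> u" "u \<le> v" "v \<le> y"
    have "integral {u..v} (\<lambda>t. f t - g t) = integ u v - (prim v - prim u)"
      using uv assms integral_g[of u v] f_int[of u v] g_int[of u v]
      by (simp add: Henstock_Kurzweil_Integration.integral_diff integ_def)
    also have "\<dots> = 0" using prim_diff[of u v] uv assms by simp
    finally show "integral {u..v} (\<lambda>t. f t - g t) = 0" .
  qed
  then show ?thesis by eventually_elim simp
qed

lemma osci_le: "lo < x \<Longrightarrow> x < y \<Longrightarrow> y < hi \<Longrightarrow> 4 * osci x y \<le> g y - g x"
  by (intro upper g_mono_on f_eq_g) auto

text \<open>At a jump the mean oscillation over small centred intervals would be half of the jump, but it is
  at most a quarter.\<close>

lemma isCont_g: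
  assumes y: "lo < y" "y < hi"
  shows "isCont g y"
proof -
  define R L where "R = Inf (g ` {y<..<hi})" and "L = Sup (g ` {lo<..<y})"
  have ne: "{y<..<hi} \<noteq> {}" "{lo<..<y} \<noteq> {}" using y by auto
  have bb: "bdd_below (g ` {y<..<hi})" "bdd_above (g ` {lo<..<y})"
    using y by (auto intro!: bdd_belowI[of _ "g y"] bdd_aboveI[of _ "g y"] g_le)
  have R: "R \<le> g u" if "y < u" "u < hi" for u
    unfolding R_def by (intro cInf_lower bb) (use that in auto)
  have L: "g u \<le> L" if "lo < u" "u < y" for u
    unfolding L_def by (intro cSup_upper bb) (use that in auto)
  have RL: "g y \<le> R" "L \<le> g y"
    unfolding R_def L_def using ne y by (auto intro!: cInf_greatest cSup_least g_le)
  have jump: "2 * (R - L) \<le> g (y + h) - g (y - h)" if h: "h > 0" "lo < y - h" "y + h < hi" for h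
  proof -
    \<comment> \<open>The integrals are taken over open intervals because \<open>R\<close> bounds
      \<open>g\<close> only strictly to the right of \<open>y\<close>; the value \<open>g y\<close>
      may be smaller. The same holds for \<open>L\<close> on the left.\<close>
    have "integral {y..y+h} (\<lambda>_. R) \<le> integral {y..y+h} g"
      unfolding integral_open_interval_real
      using g_int[of y "y+h"] y h
      by (intro integral_le) (auto simp: integrable_on_open_interval_real integrable_const_ivl intro!: R)
    then have "R * h \<le> integral {y..y+h} g"
      using h by (simp add: mult.commute[of h])
    then have 1: "R \<le> mean y (y + h)"
      using integral_g[of y "y+h"] mean_prim[of y "y+h"] y h by (simp add: le_divide_eq)
    have "integral {y-h..y} g \<le> integral {y-h..y} (\<lambda>_. L)"
      unfolding integral_open_interval_real
      using g_int[of "y-h" y] y h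
      by (intro integral_le) (auto simp: integrable_on_open_interval_real integrable_const_ivl intro!: L)
    then have "integral {y-h..y} g \<le> L * h"
      using h by (simp add: mult.commute[of h])
    then have 2: "mean (y - h) y \<le> L"
      using integral_g[of "y-h" y] mean_prim[of "y-h" y] y h by (simp add: divide_le_eq)
    have "\<bar>mean y (y + h) - mean (y - h) y\<bar> \<le> 2 * osci (y - h) (y + h)"
      by (rule osci_halves(2)[OF h(2,1,3)])
    moreover have "4 * osci (y - h) (y + h) \<le> g (y + h) - g (y - h)" using h by (intro osci_le) auto
    ultimately show ?thesis using 1 2 by argo
  qed
  have near: "\<exists>u v. lo < v \<and> v < y \<and> y < u \<and> u < hi \<and> g u < R + e \<and> L - e < g v" if "e > 0" for e
  proof -
    have "\<exists>t\<in>g ` {y<..<hi}. t < R + e"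
      by (rule cInf_lessD) (use ne that in \<open>auto simp: R_def\<close>)
    then obtain u where u: "y < u" "u < hi" "g u < R + e" by auto
    have "\<exists>t\<in>g ` {lo<..<y}. L - e < t"
      by (rule less_cSupD) (use ne that in \<open>auto simp: L_def\<close>)
    then obtain v where "lo < v" "v < y" "L - e < g v" by auto
    with u show ?thesis by blast
  qed
  have "R \<le> L"
  proof (rule ccontr)
    assume "\<not> R \<le> L"
    \<comment> \<open>A slack of \<open>(R - L) / 2\<close> on each side makes
      \<open>g u - g v\<close> smaller than \<open>2 * (R - L)\<close>, against
      \<open>jump\<close>.\<close>
    then have "(R - L) / 2 > 0" by simp
    from near[OF this] obtain u v where uv: "lo < v" "v < y" "y < u" "u < hi"
        "g u < R + (R - L) / 2" "L - (R - L) / 2 < g v" by blast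
    define h where "h = min (u - y) (y - v)"
    have h: "h > 0" "y + h \<le> u" "v \<le> y - h" using uv by (auto simp: h_def)
    have "2 * (R - L) \<le> g (y + h) - g (y - h)" using h uv by (intro jump) auto
    moreover have "g (y + h) \<le> g u" "g v \<le> g (y - h)" using h uv by (auto intro!: g_le)
    moreover have "g u - g v < 2 * (R - L)" using uv(5,6) by (simp add: field_simps)
    ultimately show False by linarith
  qed
  then have eq: "R = g y" "L = g y" using RL by linarith+
  show ?thesis unfolding isCont_def
  proof (rule tendstoI)
    fix e :: real assume "e > 0"
    from near[OF this] obtain u v where uv: "lo < v" "v < y" "y < u" "u < hi" "g u < g y + e" "g y - e < g v"
      unfolding eq by blast
    have "\<forall>\<^sub>F z in at y. z \<in> {v<..<u}" by (rule eventually_at_in_open') (use uv in auto)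
    then show "\<forall>\<^sub>F z in at y. dist (g z) (g y) < e"
    proof eventually_elim
      case (elim z)
      have "g v \<le> g z" "g z \<le> g u" using elim uv by (auto intro!: g_le)
      then show ?case using uv(5,6) by (simp add: dist_real_def abs_less_iff)
    qed
  qed
qed

text \<open>Summing the oscillation over pairs of neighbouring cells of a uniform partition, each point is
  covered twice.\<close>

lemma osci_partition:
  assumes "lo < x" "h > 0"
  shows "x + (real k + 2) * h < hi \<Longrightarrow>
    mean (x + (real k + 1) * h) (x + (real k + 2) * h) - mean x (x + h)
      \<le> 2 * (osci x (x + (real k + 1) * h) + osci x (x + (real k + 2) * h))"
proof (induction k)
  case 0
  have "\<bar>mean (x + h) (x + h + h) - mean (x + h - h) (x + h)\<bar> \<le> 2 * osci (x + h - h) (x + h + h)"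
    using assms 0 by (intro osci_halves) auto
  moreover have "osci x (x + h) \<ge> 0" using assms by (intro osci_nonneg) auto
  moreover have "x + h + h = x + 2 * h" by simp
  ultimately show ?case by simp
next
  case (Suc k)
  define p q r where "p = x + (real k + 1) * h" and "q = x + (real k + 2) * h" and "r = x + (real k + 3) * h"
  have pqr: "q - h = p" "q + h = r" by (simp_all add: p_def q_def r_def algebra_simps)
  have sk: "x + (real (Suc k) + 1) * h = q" "x + (real (Suc k) + 2) * h = r"
    by (simp_all add: q_def r_def algebra_simps)
  have xp: "x < p" using assms by (simp add: p_def)
  have rhi: "r < hi" using Suc.prems unfolding sk .
  have "mean p q - mean x (x + h) \<le> 2 * (osci x p + osci x q)"
    using Suc.IH rhi pqr assms unfolding p_def q_def by simp
  moreover
  have "\<bar>mean q (q + h) - mean (q - h) q\<bar> \<le> 2 * osci (q - h) (q + h)"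
    using xp rhi pqr assms by (intro osci_halves) auto
  then have "mean q (q + h) - mean (q - h) q \<le> 2 * osci (q - h) (q + h)" by (rule abs_le_D1)
  \<comment> \<open>The new pair of cells fills \<open>p\<close> to \<open>r\<close>, so it extends
    the chain of disjoint pairs ending at \<open>p\<close>, while the chain ending at
    \<open>q\<close> stays. The two chains take turns.\<close>
  moreover have "osci x p + osci p r \<le> osci x r" using xp rhi pqr assms by (intro super) auto
  ultimately show ?case unfolding sk pqr by argo
qed

text \<open>With \<open>n + 2\<close> equal cells, \<open>osci_partition\<close> compares the means
  over the first and last cell, which bound the increment of \<open>g\<close> short of one cell at
  each end. Continuity of \<open>g\<close> recovers the full increment in the limit.\<close>

lemma osci_ge:
  assumes "lo < x" "x < y" "y < hi"
  shows "g y - g x \<le> 4 * osci x y"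
proof -
  have b: "g (y - (y - x) / real (n + 2)) - g (x + (y - x) / real (n + 2)) \<le> 4 * osci x y" for n :: nat
  proof -
    define h where "h = (y - x) / real (n + 2)"
    have h: "h > 0" "x + (real n + 2) * h = y" using assms by (simp_all add: h_def add.commute)
    have yh: "x + (real n + 1) * h = y - h" using h(2) by (simp add: algebra_simps)
    have xyh: "x + h \<le> y - h"
    proof -
      have "2 * h \<le> (real n + 2) * h" using h(1) by (intro mult_right_mono) auto
      then show ?thesis using h(2) by (simp add: algebra_simps)
    qed
    have xyh': "x < y - h" "x + h < y" using xyh h(1) by linarith+
    have "mean (y - h) y - mean x (x + h) \<le> 2 * (osci x (y - h) + osci x y)"
      using osci_partition[of x h n] assms h unfolding yh h(2) by simp
    moreover have "osci x (y - h) \<le> osci x y" using assms h(1) xyh' by (intro osci_mono) auto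
    moreover have "g (y - h) \<le> mean (y - h) y" "mean x (x + h) \<le> g (x + h)"
      using assms h(1) xyh' by (auto intro!: mean_bounds)
    ultimately show ?thesis unfolding h_def[symmetric] by argo
  qed
  have "(\<lambda>n. (y - x) / real (n + 2)) \<longlonglongrightarrow> 0"
    by (rule LIMSEQ_ignore_initial_segment[OF lim_const_over_n])
  then have "(\<lambda>n. g (y - (y - x) / real (n + 2)) - g (x + (y - x) / real (n + 2))) \<longlonglongrightarrow> g (y - 0) - g (x + 0)"
    using isCont_g[of x] isCont_g[of y] assms
    by (intro tendsto_diff isCont_tendsto_compose[of _ g] tendsto_add tendsto_const) simp_all
  then show ?thesis by (intro LIMSEQ_le_const2[where a = "4 * osci x y"]) (use b in \<open>auto\<close>)
qed

sublocale increasing_osc_identity lo hi g prim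
proof
  show "(prim has_real_derivative g x) (at x)" if x: "lo < x" "x < hi" for x
  proof -
    obtain u where u: "lo < u" "u < x" using dense x by blast
    obtain v where v: "x < v" "v < hi" using dense x by blast
    have "continuous_on {u..v} g"
      using u v by (intro continuous_at_imp_continuous_on) (auto intro!: isCont_g)
    then have "((\<lambda>z. integral {u..z} g) has_real_derivative g x) (at x within {u..v})"
      using u v by (intro integral_has_real_derivative) auto
    then have "((\<lambda>z. prim u + integral {u..z} g) has_real_derivative 0 + g x) (at x)"
      using u v at_within_Icc_at[of u x v] by (intro DERIV_add DERIV_const) simp
    then have "((\<lambda>z. prim u + integral {u..z} g) has_real_derivative g x) (at x)" by simp
    then show ?thesis
    proof (rule has_field_derivative_transform_within_open[where S = "{u<..<v}"])
      fix z assume "z \<in> {u<..<v}"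
      then show "prim u + integral {u..z} g = prim z" using integral_g[of u z] u v by simp
    qed (use u v in auto)
  qed
  show "isCont g x" if "lo < x" "x < hi" for x using isCont_g that .
  show "g x < g y" if "lo < x" "x < y" "y < hi" for x y using g_less that .
  fix x t y assume b: "lo < x" "x < t" "t < y" "y < hi" and m: "prim y - prim x = g t * (y - x)"
  have gt: "mean x y = g t" using m b by (simp add: mean_prim)
  have dev: "dev u v (g t) = integral {u..v} (\<lambda>s. \<bar>g s - g t\<bar>)" if uv: "lo < u" "u \<le> v" "v < hi" for u v
  proof -
    obtain N where N: "negligible N" "{s. \<not> (s \<in> {u..v} \<longrightarrow> f s = g s)} \<subseteq> N"
      using f_eq_g[OF uv] unfolding eventually_ae_filter_negligible by blast
    show ?thesis unfolding dev_def by (rule integral_spike[OF N(1)]) (use N(2) in auto)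
  qed
  show "8 * (prim y - prim t - g t * (y - t)) = (y - x) * (g y - g x)"
  proof -
    have "(y - x) * osci x y = dev x t (g t) + dev t y (g t)"
      using dev_add[of x t y "g t"] dev_mean[of x y] gt b by (simp add: mult.commute)
    also have "dev x t (g t) = integral {x..t} (\<lambda>s. g t - g s)"
      unfolding dev[OF b(1) less_imp_le[OF b(2)] order.strict_trans[OF b(3,4)]]
      by (rule Henstock_Kurzweil_Integration.integral_cong) (use g_le b in force)
    also have "\<dots> = g t * (t - x) - (prim t - prim x)"
      using b g_int[of x t] integral_g[of x t]
      by (simp add: Henstock_Kurzweil_Integration.integral_diff integrable_const_ivl mult.commute)
    also have "dev t y (g t) = integral {t..y} (\<lambda>s. g s - g t)"
      unfolding dev[OF order.strict_trans[OF b(1,2)] less_imp_le[OF b(3)] b(4)]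
      by (rule Henstock_Kurzweil_Integration.integral_cong) (use g_le b in force)
    also have "\<dots> = (prim y - prim t) - g t * (y - t)"
      using b g_int[of t y] integral_g[of t y]
      by (simp add: Henstock_Kurzweil_Integration.integral_diff integrable_const_ivl mult.commute)
    \<comment> \<open>As \<open>g t\<close> is the mean value, the parts on the two sides of
      \<open>t\<close> contribute equally.\<close>
    also have "g t * (t - x) - (prim t - prim x) + (prim y - prim t - g t * (y - t))
        = 2 * (prim y - prim t - g t * (y - t))"
      using m by (simp add: algebra_simps)
    finally have "4 * ((y - x) * osci x y) = 8 * (prim y - prim t - g t * (y - t))" by simp
    moreover have "4 * osci x y = g y - g x"
      using osci_le[of x y] osci_ge[of x y] b by simp
    ultimately show ?thesis by (simp add: mult.left_commute[of 4])
  qed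
qed

end

section \<open>Total variation\<close>

lemma AE_open_interval:
  fixes a b :: real
  assumes "\<And>x y. a < x \<Longrightarrow> x < y \<Longrightarrow> y < b \<Longrightarrow> AE t in lebesgue. t \<in> {x..y} \<longrightarrow> P t"
  shows "AE t in lebesgue. t \<in> {a<..<b} \<longrightarrow> P t"
proof (cases "a < b")
  case True
  \<comment> \<open>The summand 3 keeps every interval \<open>{a + e n..b - e n}\<close>
    nondegenerate, including the one for \<open>n = 0\<close>. These countably many intervals
    exhaust the open one.\<close>
  define e where "e n = (b - a) / (real n + 3)" for n :: nat
  have e: "e n > 0" "2 * e n < b - a" for n
  proof -
    show "e n > 0" using True by (simp add: e_def)
    have "2 * (b - a) < (real n + 3) * (b - a)" using True by (intro mult_strict_right_mono) auto
    then show "2 * e n < b - a" by (simp add: e_def divide_less_eq mult.commute)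
  qed
  have "AE t in lebesgue. \<forall>n. t \<in> {a + e n..b - e n} \<longrightarrow> P t"
    unfolding AE_all_countable
  proof
    fix n show "AE t in lebesgue. t \<in> {a + e n..b - e n} \<longrightarrow> P t"
      using e[of n] by (intro assms) auto
  qed
  then show ?thesis
  proof eventually_elim
    case (elim t)
    show ?case
    proof
      assume t: "t \<in> {a<..<b}"
      define d where "d = min (t - a) (b - t)"
      have d: "d > 0" "a + d \<le> t" "t \<le> b - d" using t by (auto simp: d_def)
      obtain n :: nat where n: "(b - a) / d < real n" using reals_Archimedean2 by blast
      then have "b - a < real n * d" using d(1) by (simp add: divide_less_eq)
      also have "\<dots> \<le> (real n + 3) * d" using d(1) by simp
      finally have "e n < d" by (simp add: e_def divide_less_eq mult.commute)
      then show "P t" using elim[rule_format, of n] d by simp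
    qed
  qed
qed simp

section \<open>Test functions and their pairing with the function\<close>

lemma test_functionD:
  assumes "\<phi> \<in> test_functions I"
  shows "(\<phi> has_real_derivative deriv \<phi> t) (at t)" and "isCont (deriv \<phi>) t"
    and "t \<notin> I \<Longrightarrow> \<phi> t = 0" and "t \<notin> I \<Longrightarrow> deriv \<phi> t = 0"
proof -
  have fd: "\<And>n t. (deriv ^^ n) \<phi> field_differentiable at t"
    and sub: "closure {x. \<phi> x \<noteq> 0} \<subseteq> I"
    using assms unfolding test_functions_def by blast+
  show "(\<phi> has_real_derivative deriv \<phi> t) (at t)"
    using fd[of 0 t] by (simp add: DERIV_deriv_iff_field_differentiable)
  show "isCont (deriv \<phi>) t"
    using field_differentiable_imp_continuous_at[OF fd[of 1 t]] by simp
  assume t: "t \<notin> I"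
  then have tc: "t \<in> - closure {x. \<phi> x \<noteq> 0}" using sub by blast
  then show "\<phi> t = 0" using closure_subset[of "{x. \<phi> x \<noteq> 0}"] by auto
  have "((\<lambda>_. 0) has_real_derivative 0) (at t)" by (rule DERIV_const)
  then have "(\<phi> has_real_derivative 0) (at t)"
  proof (rule has_field_derivative_transform_within_open[OF _ _ tc])
    fix x assume "x \<in> - closure {x. \<phi> x \<noteq> 0}"
    then show "0 = \<phi> x" using closure_subset[of "{x. \<phi> x \<noteq> 0}"] by auto
  qed (simp_all add: open_Compl)
  then show "deriv \<phi> t = 0" by (rule DERIV_imp_deriv)
qed

lemma higher_deriv_add_real:
  fixes \<phi> \<psi> :: "real \<Rightarrow> real"
  assumes "\<And>n t. (deriv ^^ n) \<phi> field_differentiable at t" "\<And>n t. (deriv ^^ n) \<psi> field_differentiable at t"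
  shows "(deriv ^^ n) (\<lambda>t. \<phi> t + \<psi> t) = (\<lambda>t. (deriv ^^ n) \<phi> t + (deriv ^^ n) \<psi> t)"
proof (induction n)
  case (Suc n)
  show ?case using assms by (simp add: Suc fun_eq_iff)
qed simp

lemma test_functions_add:
  assumes \<phi>: "\<phi> \<in> test_functions I" and \<psi>: "\<psi> \<in> test_functions J" and K: "I \<subseteq> K" "J \<subseteq> K"
  shows "(\<lambda>t. \<phi> t + \<psi> t) \<in> test_functions K"
proof -
  let ?A = "closure {x. \<phi> x \<noteq> 0}" and ?B = "closure {x. \<psi> x \<noteq> 0}"
  let ?C = "closure {x. \<phi> x + \<psi> x \<noteq> 0}"
  have fd: "\<And>n t. (deriv ^^ n) \<phi> field_differentiable at t" "\<And>n t. (deriv ^^ n) \<psi> field_differentiable at t"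
    and c: "compact ?A" "compact ?B" and sub: "?A \<subseteq> I" "?B \<subseteq> J"
    using \<phi> \<psi> unfolding test_functions_def by blast+
  have cAB: "compact (?A \<union> ?B)" using c by (rule compact_Un)
  have CAB: "?C \<subseteq> ?A \<union> ?B"
  proof (rule closure_minimal)
    show "{x. \<phi> x + \<psi> x \<noteq> 0} \<subseteq> ?A \<union> ?B"
      using closure_subset[of "{x. \<phi> x \<noteq> 0}"] closure_subset[of "{x. \<psi> x \<noteq> 0}"] by force
  qed (use cAB compact_imp_closed in blast)
  have "compact ((?A \<union> ?B) \<inter> ?C)" by (intro compact_Int_closed cAB) simp
  then have "compact ?C" using CAB by (simp add: Int_absorb1)
  moreover have "?C \<subseteq> K" using CAB sub K by blast
  moreover have "(deriv ^^ n) (\<lambda>t. \<phi> t + \<psi> t) field_differentiable at t" for n t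
    unfolding higher_deriv_add_real[OF fd] using fd by (intro field_differentiable_add)
  ultimately show ?thesis by (simp add: test_functions_def)
qed

context local_integrable
begin

lemma set_integral_eq:
  fixes h :: "real \<Rightarrow> real"
  assumes "lo < x" "x < y" "y < hi" and h: "h absolutely_integrable_on {x..y}"
  shows "(LINT t:{x<..<y}|lebesgue. h t) = integral {x..y} h"
  using h set_lebesgue_integral_eq_integral(2)[of "{x<..<y}" h]
  by (simp add: absolutely_integrable_on_Icc_iff_Ioo[symmetric] integral_open_interval_real[symmetric])

lemma mean_value_eq: "lo < x \<Longrightarrow> x < y \<Longrightarrow> y < hi \<Longrightarrow> mean_value f {x<..<y} = mean x y"
  using set_integral_eq[of x y f] abs_int[of x y]
  by (simp add: mean_value_def mean_def integ_def)

lemma osc_eq: "lo < x \<Longrightarrow> x < y \<Longrightarrow> y < hi \<Longrightarrow> osc f {x<..<y} = osci x y"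
  using set_integral_eq[of x y "\<lambda>t. \<bar>f t - mean x y\<bar>"] dev_abs_int[of x y "mean x y", THEN set_integrable_abs]
  by (simp add: osc_def mean_value_eq osci_def dev_def)

lemma test_abs_int:
  assumes "lo < x" "x \<le> y" "y < hi" and \<phi>: "\<phi> \<in> test_functions I"
  shows "(\<lambda>t. f t * deriv \<phi> t) absolutely_integrable_on {x..y}"
proof -
  have c: "continuous_on {x..y} (deriv \<phi>)"
    using test_functionD(2)[OF \<phi>] by (simp add: continuous_at_imp_continuous_on)
  have "(\<lambda>t. deriv \<phi> t * f t) absolutely_integrable_on {x..y}"
  proof (rule absolutely_integrable_bounded_measurable_product_real)
    show "deriv \<phi> \<in> borel_measurable (lebesgue_on {x..y})"
      using c by (rule continuous_imp_measurable_on_sets_lebesgue) simp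
    show "bounded (deriv \<phi> ` {x..y})" by (intro compact_imp_bounded compact_continuous_image c) simp
  qed (use assms abs_int in auto)
  then show ?thesis by (simp add: mult.commute)
qed

definition pairing :: "real \<Rightarrow> real \<Rightarrow> (real \<Rightarrow> real) \<Rightarrow> real" where
  "pairing x y \<phi> = integral {x..y} (\<lambda>t. f t * deriv \<phi> t)"

lemma pairing_extend:
  assumes b: "lo < x" "x \<le> u" "u < v" "v \<le> y" "y < hi" and \<phi>: "\<phi> \<in> test_functions {u<..<v}"
  shows "pairing x y \<phi> = pairing u v \<phi>"
proof -
  let ?h = "\<lambda>t. f t * deriv \<phi> t"
  have i: "?h integrable_on {p..q}" if "lo < p" "p \<le> q" "q < hi" for p q
    by (rule set_lebesgue_integral_eq_integral(1)[OF test_abs_int[OF that \<phi>]])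
  have z: "?h t = 0" if "t \<notin> {u<..<v}" for t using test_functionD(4)[OF \<phi> that] by simp
  have z1: "integral {x..u} ?h = 0"
    by (rule integral_unique[OF has_integral_is_0], rule z) simp
  have z2: "integral {v..y} ?h = 0"
    by (rule integral_unique[OF has_integral_is_0], rule z) simp
  have "integral {x..u} ?h + integral {u..y} ?h = integral {x..y} ?h"
    by (rule Henstock_Kurzweil_Integration.integral_combine) (use b i in auto)
  moreover have "integral {u..v} ?h + integral {v..y} ?h = integral {u..y} ?h"
    by (rule Henstock_Kurzweil_Integration.integral_combine) (use b i in auto)
  ultimately show ?thesis using z1 z2 by (simp add: pairing_def)
qed

lemma pairing_add:
  assumes b: "lo < x" "x \<le> y" "y < hi" and \<phi>: "\<phi> \<in> test_functions I" and \<psi>: "\<psi> \<in> test_functions J"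
  shows "pairing x y (\<lambda>t. \<phi> t + \<psi> t) = pairing x y \<phi> + pairing x y \<psi>"
proof -
  have "deriv (\<lambda>t. \<phi> t + \<psi> t) t = deriv \<phi> t + deriv \<psi> t" for t
    by (intro DERIV_imp_deriv DERIV_add test_functionD(1)[OF \<phi>] test_functionD(1)[OF \<psi>])
  moreover have "(\<lambda>t. f t * deriv \<phi> t) integrable_on {x..y}" "(\<lambda>t. f t * deriv \<psi> t) integrable_on {x..y}"
    by (rule set_lebesgue_integral_eq_integral(1)[OF test_abs_int[OF b \<phi>]],
        rule set_lebesgue_integral_eq_integral(1)[OF test_abs_int[OF b \<psi>]])
  ultimately show ?thesis
    unfolding pairing_def by (simp add: distrib_left Henstock_Kurzweil_Integration.integral_add)
qed

end

text \<open>The second mean value theorem for integrals takes the place of integration by parts: it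
  evaluates the integral as \<open>- ((g y - g x) * \<phi> c)\<close> for a single point
  \<open>c\<close>, without any regularity of \<open>g\<close>.\<close>

lemma monotone_pairing_bound:
  fixes g :: "real \<Rightarrow> real"
  assumes xy: "x < y" and g: "mono_on {x..y} g" and \<phi>: "\<phi> \<in> test_functions {x<..<y}"
    and ae: "AE t in lebesgue. t \<in> {x<..<y} \<longrightarrow> \<bar>\<phi> t\<bar> \<le> 1"
  shows "\<bar>integral {x..y} (\<lambda>t. g t * deriv \<phi> t)\<bar> \<le> g y - g x"
proof -
  note D = test_functionD[OF \<phi>]
  have FTC: "(deriv \<phi> has_integral (\<phi> v - \<phi> u)) {u..v}" if "u \<le> v" for u v
  proof (rule fundamental_theorem_of_calculus[OF that])
    fix t show "(\<phi> has_vector_derivative deriv \<phi> t) (at t within {u..v})"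
      using has_field_derivative_at_within[OF D(1)[of t]]
      by (simp add: has_real_derivative_iff_has_vector_derivative)
  qed
  have "deriv \<phi> integrable_on {x..y}" using has_integral_integrable[OF FTC[OF less_imp_le[OF xy]]] .
  moreover have "g u \<le> g v" if "x \<le> u" "u \<le> v" "v \<le> y" for u v
    using that by (intro mono_onD[OF g]) auto
  ultimately obtain c where c: "c \<in> {x..y}" and
    eq: "integral {x..y} (\<lambda>t. g t * deriv \<phi> t) = g x * integral {x..c} (deriv \<phi>) + g y * integral {c..y} (deriv \<phi>)"
    by (rule second_mean_value_theorem[OF _ less_imp_le[OF xy]])
  have "\<phi> x = 0" "\<phi> y = 0" using D(3) by simp_all
  then have "integral {x..c} (deriv \<phi>) = \<phi> c" "integral {c..y} (deriv \<phi>) = - \<phi> c"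
    using integral_unique[OF FTC[of x c]] integral_unique[OF FTC[of c y]] c by simp_all
  then have "integral {x..y} (\<lambda>t. g t * deriv \<phi> t) = - ((g y - g x) * \<phi> c)"
    unfolding eq by (simp add: algebra_simps)
  moreover have "\<bar>\<phi> c\<bar> \<le> 1"
  proof (cases "c \<in> {x<..<y}")
    case True
    \<comment> \<open>Continuity turns the almost-everywhere bound into a bound at the particular
      point \<open>c\<close>.\<close>
    have "continuous_on UNIV \<phi>"
      by (intro continuous_at_imp_continuous_on ballI DERIV_isCont[OF D(1)])
    then have "closed (\<phi> -` {-1..1})" by (rule closed_vimage[OF closed_atLeastAtMost])
    moreover have "AE t in lebesgue. t \<in> {x<..<y} \<longrightarrow> t \<in> \<phi> -` {-1..1}"
      using ae by eventually_elim auto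
    ultimately have "c \<in> \<phi> -` {-1..1}"
      using True by (rule mem_closed_if_AE_lebesgue_open[OF open_greaterThanLessThan])
    then have "-1 \<le> \<phi> c" "\<phi> c \<le> 1" by simp_all
    then show ?thesis by simp
  next
    case False then show ?thesis using D(3) by simp
  qed
  moreover have "g x \<le> g y" using xy by (intro mono_onD[OF g]) auto
  ultimately show ?thesis
    using mult_left_le[of "\<bar>\<phi> c\<bar>" "g y - g x"] by (simp add: abs_mult)
qed

section \<open>From the total variation to superadditive oscillation\<close>

locale quarter_variation =
  fixes lo hi :: real and f :: "real \<Rightarrow> real"
  assumes loc: "f locally_integrable_on {lo<..<hi}"
    and tv: "\<And>x y. lo < x \<Longrightarrow> x < y \<Longrightarrow> y < hi \<Longrightarrow>
      ereal (osc f {x<..<y}) = ereal (1 / 4) * total_variation f {x<..<y}"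
begin

sublocale local_integrable lo hi f
proof
  fix x y assume "lo < x" "x \<le> y" "y < hi"
  then have "{x..y} \<subseteq> {lo<..<hi}" by auto
  then show "f absolutely_integrable_on {x..y}"
    using loc compact_Icc[of x y] unfolding locally_integrable_on_def by blast
qed

definition admissible :: "real \<Rightarrow> real \<Rightarrow> (real \<Rightarrow> real) set" where
  "admissible x y = {\<phi> \<in> test_functions {x<..<y}. AE t in lebesgue. t \<in> {x<..<y} \<longrightarrow> \<bar>\<phi> t\<bar> \<le> 1}"

lemma osci_tv:
  assumes b: "lo < x" "x < y" "y < hi"
  shows "(SUP \<phi>\<in>admissible x y. ereal (pairing x y \<phi>)) = ereal (4 * osci x y)"
proof -
  have "(LINT t:{x<..<y}|lebesgue. f t * deriv \<phi> t) = pairing x y \<phi>" if "\<phi> \<in> admissible x y" for \<phi>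
    unfolding pairing_def using that b
    by (intro set_integral_eq test_abs_int[where I = "{x<..<y}"]) (auto simp: admissible_def)
  then have "total_variation f {x<..<y} = (SUP \<phi>\<in>admissible x y. ereal (pairing x y \<phi>))"
    unfolding total_variation_def admissible_def[symmetric] by (intro SUP_cong) auto
  \<comment> \<open>The oscillation is a real number, so the hypothesis rules out infinite
    variation.\<close>
  moreover have "total_variation f {x<..<y} = ereal (4 * osci x y)"
    using tv[OF b] osc_eq[OF b] by (cases "total_variation f {x<..<y}") auto
  ultimately show ?thesis by simp
qed

lemma pairing_le: "lo < x \<Longrightarrow> x < y \<Longrightarrow> y < hi \<Longrightarrow> \<phi> \<in> admissible x y \<Longrightarrow> pairing x y \<phi> \<le> 4 * osci x y"
  using SUP_upper[of \<phi> "admissible x y" "\<lambda>\<phi>. ereal (pairing x y \<phi>)"] osci_tv[of x y] by simp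

lemma osci_least:
  assumes b: "lo < x" "x < y" "y < hi" and c: "\<And>\<phi>. \<phi> \<in> admissible x y \<Longrightarrow> pairing x y \<phi> \<le> c"
  shows "4 * osci x y \<le> c"
proof -
  have "(SUP \<phi>\<in>admissible x y. ereal (pairing x y \<phi>)) \<le> ereal c" by (rule SUP_least) (simp add: c)
  then show ?thesis unfolding osci_tv[OF b] by simp
qed

text \<open>At each point at most one of the two summands is nonzero, so the bound 1 survives
  addition.\<close>

lemma admissible_add:
  assumes b: "x < y" "y < z" and \<phi>: "\<phi> \<in> admissible x y" and \<psi>: "\<psi> \<in> admissible y z"
  shows "(\<lambda>t. \<phi> t + \<psi> t) \<in> admissible x z"
proof -
  have t: "\<phi> \<in> test_functions {x<..<y}" "\<psi> \<in> test_functions {y<..<z}"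
    and ae: "AE t in lebesgue. t \<in> {x<..<y} \<longrightarrow> \<bar>\<phi> t\<bar> \<le> 1" "AE t in lebesgue. t \<in> {y<..<z} \<longrightarrow> \<bar>\<psi> t\<bar> \<le> 1"
    using \<phi> \<psi> by (simp_all add: admissible_def)
  have sum: "(\<lambda>t. \<phi> t + \<psi> t) \<in> test_functions {x<..<z}"
    using t by (rule test_functions_add) (use b in auto)
  from ae have "AE t in lebesgue. t \<in> {x<..<z} \<longrightarrow> \<bar>\<phi> t + \<psi> t\<bar> \<le> 1"
  proof eventually_elim
    case (elim t)
    have "t \<notin> {x<..<y} \<or> t \<notin> {y<..<z}" by simp
    then consider "t \<in> {x<..<y}" "t \<notin> {y<..<z}" | "t \<notin> {x<..<y}" "t \<in> {y<..<z}" | "t \<notin> {x<..<y}" "t \<notin> {y<..<z}"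
      by blast
    then show ?case
      by cases (use elim test_functionD(3)[OF t(1), of t] test_functionD(3)[OF t(2), of t] in simp_all)
  qed
  with sum show ?thesis by (simp add: admissible_def)
qed

text \<open>Admissible functions on neighbouring intervals add up to one on their union, and the
  pairings add. The supremum is taken first over \<open>\<phi>\<close> with \<open>\<psi>\<close>
  fixed, then over \<open>\<psi>\<close>.\<close>

sublocale superadditive_osc lo hi f
proof
  fix x y z assume b: "lo < x" "x < y" "y < z" "z < hi"
  have sum: "pairing x y \<phi> + pairing y z \<psi> \<le> 4 * osci x z"
    if \<phi>: "\<phi> \<in> admissible x y" and \<psi>: "\<psi> \<in> admissible y z" for \<phi> \<psi>
  proof -
    have t: "\<phi> \<in> test_functions {x<..<y}" "\<psi> \<in> test_functions {y<..<z}"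
      using \<phi> \<psi> by (simp_all add: admissible_def)
    have "pairing x z (\<lambda>t. \<phi> t + \<psi> t) = pairing x z \<phi> + pairing x z \<psi>"
      by (rule pairing_add[OF _ _ _ t]) (use b in auto)
    moreover have "pairing x z \<phi> = pairing x y \<phi>" by (rule pairing_extend[OF _ _ _ _ _ t(1)]) (use b in auto)
    moreover have "pairing x z \<psi> = pairing y z \<psi>" by (rule pairing_extend[OF _ _ _ _ _ t(2)]) (use b in auto)
    moreover have "pairing x z (\<lambda>t. \<phi> t + \<psi> t) \<le> 4 * osci x z"
      using b by (intro pairing_le admissible_add[OF b(2,3) \<phi> \<psi>]) auto
    ultimately show ?thesis by simp
  qed
  have "4 * osci x y \<le> 4 * osci x z - pairing y z \<psi>" if "\<psi> \<in> admissible y z" for \<psi>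
    using b sum[OF _ that] by (intro osci_least) (auto simp: le_diff_eq)
  then have "4 * osci y z \<le> 4 * osci x z - 4 * osci x y"
    using b by (intro osci_least) (auto simp: le_diff_eq add.commute)
  then show "osci x y + osci y z \<le> osci x z" by simp
qed

text \<open>The sign \<open>s\<close> serves increasing and decreasing functions at once; it
  disappears because \<open>monotone_pairing_bound\<close> bounds an absolute value.\<close>

lemma osci_le_monotone:
  assumes b: "lo < x" "x < y" "y < hi" and g: "mono_on {x..y} g"
    and s: "\<bar>s\<bar> = 1" and fg: "AE t in lebesgue. t \<in> {x..y} \<longrightarrow> f t = s * g t"
  shows "4 * osci x y \<le> g y - g x"
proof (rule osci_least[OF b])
  fix \<phi> assume \<phi>: "\<phi> \<in> admissible x y"
  obtain N where N: "negligible N" "{t. \<not> (t \<in> {x..y} \<longrightarrow> f t = s * g t)} \<subseteq> N"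
    using fg unfolding eventually_ae_filter_negligible by blast
  have "pairing x y \<phi> = integral {x..y} (\<lambda>t. s * (g t * deriv \<phi> t))"
    unfolding pairing_def by (rule integral_spike[OF N(1)]) (use N(2) in auto)
  also have "\<dots> = s * integral {x..y} (\<lambda>t. g t * deriv \<phi> t)" by simp
  also have "\<dots> \<le> \<bar>s\<bar> * \<bar>integral {x..y} (\<lambda>t. g t * deriv \<phi> t)\<bar>"
    by (metis abs_ge_self abs_mult)
  also have "\<dots> \<le> g y - g x"
    using monotone_pairing_bound[OF b(2) g] \<phi> s by (simp add: admissible_def)
  finally show "pairing x y \<phi> \<le> g y - g x" .
qed

lemma affine_if_increasing:
  assumes "increasing_osc lo hi h"
  obtains \<alpha> \<beta> where "AE t in lebesgue. t \<in> {lo<..<hi} \<longrightarrow> h t = \<alpha> * t + \<beta>"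
proof -
  interpret I: increasing_osc lo hi h by fact
  obtain \<alpha> \<beta> where ab: "\<forall>x. lo < x \<longrightarrow> x < hi \<longrightarrow> I.g x = \<alpha> * x + \<beta>" using I.affine by blast
  have "AE t in lebesgue. t \<in> {lo<..<hi} \<longrightarrow> h t = \<alpha> * t + \<beta>"
  proof (rule AE_open_interval)
    fix x y assume b: "lo < x" "x < y" "y < hi"
    show "AE t in lebesgue. t \<in> {x..y} \<longrightarrow> h t = \<alpha> * t + \<beta>"
      using I.f_eq_g[OF b(1) less_imp_le[OF b(2)] b(3)]
    proof eventually_elim
      case (elim t)
      then show ?case using ab b by auto
    qed
  qed
  then show ?thesis by (rule that)
qed

lemma f_affine: "\<exists>\<alpha> \<beta>. AE t in lebesgue. t \<in> {lo<..<hi} \<longrightarrow> f t = \<alpha> * t + \<beta>"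
proof (cases rule: trichotomy)
  case (const c)
  have "AE t in lebesgue. t \<in> {lo<..<hi} \<longrightarrow> f t = 0 * t + c"
  proof (rule AE_open_interval)
    fix x y assume b: "lo < x" "x < y" "y < hi"
    have "AE t in lebesgue. t \<in> {x..y} \<longrightarrow> f t - c = 0"
    proof (rule AE_zero_if_integrals_zero)
      show "(\<lambda>t. f t - c) integrable_on {x..y}"
        using b by (intro integrable_diff f_int integrable_const_ivl) auto
      fix u v assume uv: "x \<le> u" "u \<le> v" "v \<le> y"
      show "integral {u..v} (\<lambda>t. f t - c) = 0"
      proof (cases "u = v")
        case False
        have "integral {u..v} (\<lambda>t. f t - c) = integ u v - (v - u) * c"
          using uv b f_int[of u v]
          by (simp add: Henstock_Kurzweil_Integration.integral_diff integ_def integrable_const_ivl)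
        moreover have "mean u v = c" using uv b False by (intro const) auto
        ultimately show ?thesis using uv False by (simp add: mean_def field_simps)
      qed simp
    qed
    then show "AE t in lebesgue. t \<in> {x..y} \<longrightarrow> f t = 0 * t + c" by eventually_elim simp
  qed
  then show ?thesis by blast
next
  case pos
  have "increasing_osc lo hi f"
  proof
    fix g x y assume "lo < x" "x < y" "y < hi" "mono_on {x..y} g" "AE t in lebesgue. t \<in> {x..y} \<longrightarrow> f t = g t"
    then show "4 * osci x y \<le> g y - g x" using osci_le_monotone[of x y g 1] by simp
  qed (rule pos)
  then show ?thesis using affine_if_increasing by metis
next
  case neg
  \<comment> \<open>This case is reduced to the increasing one for \<open>- f\<close>: the
    oscillation is unchanged, so superadditivity carries over, and the primitive changes sign. The
    upper bound is \<open>osci_le_monotone\<close> with sign -1.\<close>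
  interpret N: local_integrable lo hi "\<lambda>t. - f t"
  proof
    fix x y assume "lo < x" "x \<le> y" "y < hi"
    then have "(\<lambda>t. (-1) * f t) absolutely_integrable_on {x..y}"
      by (intro set_integrable_mult_right abs_int) auto
    then show "(\<lambda>t. - f t) absolutely_integrable_on {x..y}" by simp
  qed
  have Nint: "N.integ x y = - integ x y" for x y by (simp add: N.integ_def integ_def)
  have Nmean: "N.mean x y = - mean x y" for x y by (simp add: N.mean_def mean_def Nint)
  have Nosci: "N.osci x y = osci x y" for x y
    unfolding N.osci_def osci_def N.dev_def dev_def Nmean by (simp add: abs_minus_commute)
  have Nprim: "N.prim = (\<lambda>x. - prim x)" by (simp add: fun_eq_iff N.prim_def prim_def Nint Let_def)
  have "increasing_osc lo hi (\<lambda>t. - f t)"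
  proof (unfold_locales, unfold Nosci Nprim)
    fix x y z assume "lo < x" "x < y" "y < z" "z < hi"
    then show "osci x y + osci y z \<le> osci x z" by (rule super)
  next
    fix x h assume "h > 0" "lo < x - h" "x + h < hi"
    then show "second_difference (\<lambda>x. - prim x) x h > 0"
      using neg[of h x] by (simp add: second_difference_def)
  next
    fix g x y assume b: "lo < x" "x < y" "y < hi" "mono_on {x..y} g"
      and fg: "AE t in lebesgue. t \<in> {x..y} \<longrightarrow> - f t = g t"
    from fg have "AE t in lebesgue. t \<in> {x..y} \<longrightarrow> f t = (-1) * g t" by eventually_elim auto
    then show "4 * osci x y \<le> g y - g x" using osci_le_monotone[OF b, of "-1"] by simp
  qed
  then obtain \<alpha> \<beta> where "AE t in lebesgue. t \<in> {lo<..<hi} \<longrightarrow> - f t = \<alpha> * t + \<beta>"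
    using affine_if_increasing by metis
  then have "AE t in lebesgue. t \<in> {lo<..<hi} \<longrightarrow> f t = (- \<alpha>) * t + (- \<beta>)"
    by eventually_elim auto
  then show ?thesis by blast
qed

end

theorem theorem1:
  fixes a b :: real and f :: "real \<Rightarrow> real"
  assumes "a < b"
    and "f locally_integrable_on {a<..<b}"
    and "\<And>I. open I \<Longrightarrow> is_interval I \<Longrightarrow> I \<noteq> {} \<Longrightarrow> I \<subset>\<subset> {a<..<b} \<Longrightarrow>
           ereal (osc f I) = ereal (1 / 4) * total_variation f I"
  shows "\<exists>\<alpha> \<beta>. AE x in lebesgue. x \<in> {a<..<b} \<longrightarrow> f x = \<alpha> * x + \<beta>"
proof -
  interpret quarter_variation a b f
  proof
    fix x y assume "a < x" "x < y" "y < b"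
    then show "ereal (osc f {x<..<y}) = ereal (1 / 4) * total_variation f {x<..<y}"
      by (intro assms(3)) (auto simp: compactly_contained_def is_interval_oo)
  qed (rule assms(2))
  show ?thesis by (rule f_affine)
qed

end
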